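(* Let $H\in\mathfrak t$ be a nonzero mass linear function on a polygon $\Delta\subset\mathfrak t^*$ (that is, a simple $2$-dimensional polytope). Then one of the following statements holds: (1) $\Delta$ is a triangle; at most one edge is symmetric. (2) $\Delta$ is a $\Delta_1$ bundle over $\Delta_1$; the base facets are the asymmetric edges. (3) $\Delta$ is the product $\Delta_1\times\Delta_1$; each edge is asymmetric. In any case, $H$ is inessential.
   Context: Let $\mathfrak t$ be a finite-dimensional real vector space with dual $\mathfrak t^*$ and pairing $\langle\cdot,\cdot\rangle$. A polytope is a bounded set $\Delta=\bigcap_{i=1}^N\{x\in\mathfrak t^*\mid\langle\eta_i,x\rangle\le\kappa_i\}$ with outward conormals $\eta_i$ and support numbers $\kappa_i$, where $\Delta$ affinely spans $\mathfrak t^*$ and each facet $F_i=\Delta\cap\{\langle\eta_i,x\rangle=\kappa_i\}$ affinely spans a hyperplane. It is simple if exactly $\dim\mathfrak t$ facets meet at each vertex. Polytopes are identified up to affine isomorphism. $\Delta_1$ is the $1$-simplex (an interval). For $\kappa'\in\mathbb R^N$ let $\Delta(\kappa')=\bigcap_i\{\langle\eta_i,x\rangle\le\kappa'_i\}$, with facets $F_i(\kappa')$. The chamber $\mathcal C_\Delta\subset\mathbb R^N$ is the connected component containing $\kappa$ of the set of $\kappa'$ for which $\Delta(\kappa')$ is a simple polytope (with $N$ facets, that is, $\Delta(\kappa')$ affinely spans $\mathfrak t^*$, each of the $N$ sets $\Delta(\kappa')\cap\{\langle\eta_i,x\rangle=\kappa'_i\}$ affinely spans a hyperplane, and exactly $\dim\mathfrak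 t$ of these $N$ facets meet at each vertex). $c_\Delta(\kappa')$ is the center of mass of $\Delta(\kappa')$. $H\in\mathfrak t$ is mass linear on $\Delta$ if $\langle H,c_\Delta(\kappa')\rangle=\sum_i\gamma_i\kappa'_i+C$ on $\mathcal C_\Delta$ for some real constants $\gamma_i,C$. A facet (edge) $F_i$ is symmetric if the function $\kappa'\mapsto\langle H,c_\Delta(\kappa')\rangle$ on $\mathcal C_\Delta$ does not depend on $\kappa'_i$, and asymmetric otherwise. In (2), the set of base facets equals the set of asymmetric edges. Bundle. Two polytopes are combinatorially equivalent if there is a bijection of facets $F_i\leftrightarrow F'_i$ with $\bigcap_{i\in I}F_i\ne\emptyset$ iff $\bigcap_{i\in I}F'_i\ne\emptyset$ for all $I$. Let $\tilde\Delta\subset\tilde{\mathfrak t}^*$ and $\hat\Delta\subset\hat{\mathfrak t}^*$ be simple polytopes with facets $\tilde F_j,\hat F_i$ and outward conormals $\tilde\eta_j,\hat\eta_i$. $\Delta\subset\mathfrak t^*$ is a $\tilde\Delta$ bundle over $\hat\Delta$ if there is a short exact sequence $0\to\tilde{\mathfrak t}\xrightarrow{\iota}\mathfrak t\xrightarrow{\pi}\hat{\mathfrak t}\to0$ such that $\Delta$ is combinatorially equivalent to $\tilde\Delta\times\hat\Delta$; the facet of $\Delta$ corresponding to $\tilde F_j\times\hat\Delta$ (a fiber facet) has outward conormal $\iota(\tilde\eta_j)$ for all $j$; and the outward conormal $\hat\eta_i'$ of the facet corresponding to $\tilde\Delta\times\hat F_i$ (a base facet) satisfies $\pi(\hat\eta_i')=\hat\eta_i$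 for all $i$ (conormals being defined up to positive multiples, for suitable choices of them). Inessential. A symmetry of a polytope is an affine map $a:\mathfrak t^*\to\mathfrak t^*$ taking the polytope to itself. A robust symmetry of $\Delta$ is a linear map $\hat a:\mathfrak t^*\to\mathfrak t^*$ such that for every $\kappa'\in\mathcal C_\Delta$ there is a symmetry $a_{\kappa'}$ of $\Delta(\kappa')$ with associated linear map $\hat a$. Facets $F_i$, $F_j$ are equivalent if there is a robust symmetry $\hat a$ such that each $a_{\kappa'}$ takes $F_i(\kappa')$ to $F_j(\kappa')$; classes are viewed as subsets of $\{1,\dots,N\}$. The conormals are normalized so that for every robust symmetry $\hat a$ and every $i$ there is $j$ with $\hat a^*(\eta_i)=\eta_j$ (always possible). $H\in\mathfrak t$ is inessential if $H=\sum_i\beta_i\eta_i$ with $\beta_i\in\mathbb R$ and $\sum_{i\in I}\beta_i=0$ for every equivalence class $I$. *)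

theory Defs
  imports "HOL-Analysis.Analysis"
begin

text \<open>
  Both the vector space and its dual are modelled by one type \<open>'a :: euclidean_space\<close>, with the
  inner product as the pairing; choosing an inner product on a finite-dimensional space loses no
  generality, since none of the notions below depends on the choice (centres of mass are affinely
  equivariant). The \<open>N\<close> facets are indexed by a finite type \<open>'n\<close>, so support numbers form a
  point of \<open>real ^ 'n\<close>.
\<close>

definition poly_set :: "('n::finite \<Rightarrow> 'a::euclidean_space) \<Rightarrow> real ^ 'n \<Rightarrow> 'a set" where
  "poly_set \<eta> \<kappa> = (\<Inter>i. {x. \<eta> i \<bullet> x \<le> \<kappa> $ i})"

definition poly_facet :: "('n::finite \<Rightarrow> 'a::euclidean_space) \<Rightarrow> real ^ 'n \<Rightarrow> 'n \<Rightarrow> 'a set" where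
  "poly_facet \<eta> \<kappa> i = poly_set \<eta> \<kappa> \<inter> {x. \<eta> i \<bullet> x = \<kappa> $ i}"

definition is_polytope :: "('n::finite \<Rightarrow> 'a::euclidean_space) \<Rightarrow> real ^ 'n \<Rightarrow> bool" where
  "is_polytope \<eta> \<kappa> \<longleftrightarrow>
     bounded (poly_set \<eta> \<kappa>) \<and>
     affine hull (poly_set \<eta> \<kappa>) = UNIV \<and>
     (\<forall>i. aff_dim (poly_facet \<eta> \<kappa> i) = int DIM('a) - 1)"

text \<open>
  Facets at a vertex are counted by index. Every facet has a vertex, and the facets at a vertex
  must include \<open>dim\<close> distinct ones, so this also forces the facets to be pairwise distinct.
\<close>

definition simple_polytope :: "('n::finite \<Rightarrow> 'a::euclidean_space) \<Rightarrow> real ^ 'n \<Rightarrow> bool" where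
  "simple_polytope \<eta> \<kappa> \<longleftrightarrow>
     is_polytope \<eta> \<kappa> \<and>
     (\<forall>v. v extreme_point_of (poly_set \<eta> \<kappa>) \<longrightarrow>
          card {i. v \<in> poly_facet \<eta> \<kappa> i} = DIM('a))"

definition chamber :: "('n::finite \<Rightarrow> 'a::euclidean_space) \<Rightarrow> real ^ 'n \<Rightarrow> (real ^ 'n) set" where
  "chamber \<eta> \<kappa> = connected_component_set {\<kappa>'. simple_polytope \<eta> \<kappa>'} \<kappa>"

definition center_of_mass :: "'a::euclidean_space set \<Rightarrow> 'a" where
  "center_of_mass S = integral S (\<lambda>x. x) /\<^sub>R measure lebesgue S"

definition mass_linear ::
  "('n::finite \<Rightarrow> 'a::euclidean_space) \<Rightarrow> real ^ 'n \<Rightarrow> 'a \<Rightarrow> bool" where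
  "mass_linear \<eta> \<kappa> H \<longleftrightarrow>
     (\<exists>\<gamma> C. \<forall>\<kappa>' \<in> chamber \<eta> \<kappa>.
        H \<bullet> center_of_mass (poly_set \<eta> \<kappa>') = (\<Sum>i\<in>UNIV. \<gamma> i * \<kappa>' $ i) + C)"

definition symmetric_facet ::
  "('n::finite \<Rightarrow> 'a::euclidean_space) \<Rightarrow> real ^ 'n \<Rightarrow> 'a \<Rightarrow> 'n \<Rightarrow> bool" where
  "symmetric_facet \<eta> \<kappa> H i \<longleftrightarrow>
     (\<forall>\<kappa>' \<in> chamber \<eta> \<kappa>. \<forall>\<kappa>'' \<in> chamber \<eta> \<kappa>. (\<forall>j. j \<noteq> i \<longrightarrow> \<kappa>' $ j = \<kappa>'' $ j) \<longrightarrow>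
        H \<bullet> center_of_mass (poly_set \<eta> \<kappa>') = H \<bullet> center_of_mass (poly_set \<eta> \<kappa>''))"

abbreviation asymmetric_facet ::
  "('n::finite \<Rightarrow> 'a::euclidean_space) \<Rightarrow> real ^ 'n \<Rightarrow> 'a \<Rightarrow> 'n \<Rightarrow> bool" where
  "asymmetric_facet \<eta> \<kappa> H i \<equiv> \<not> symmetric_facet \<eta> \<kappa> H i"

definition affinely_isomorphic :: "'a::euclidean_space set \<Rightarrow> 'b::euclidean_space set \<Rightarrow> bool" where
  "affinely_isomorphic S T \<longleftrightarrow>
     (\<exists>g c. linear g \<and> bij g \<and> (\<lambda>x. g x + c) ` S = T)"

text \<open>The 1-simplex \<open>[0,1]\<close>, with its right (\<open>True\<close>) and left (\<open>False\<close>) end points as facets.\<close>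

definition Delta1_conormal :: "bool \<Rightarrow> real" where
  "Delta1_conormal b = (if b then 1 else - 1)"

definition Delta1_support :: "real ^ bool" where
  "Delta1_support = (\<chi> b. if b then 1 else 0)"

abbreviation Delta1 :: "real set" where
  "Delta1 \<equiv> poly_set Delta1_conormal Delta1_support"

lemma Delta1_eq: "Delta1 = {0..1}"
  by (auto simp: poly_set_def Delta1_conormal_def Delta1_support_def split: if_splits)

definition combinatorial_equivalence ::
  "('m \<Rightarrow> 'n) \<Rightarrow> ('m \<Rightarrow> 'b set) \<Rightarrow> ('n \<Rightarrow> 'a set) \<Rightarrow> bool" where
  "combinatorial_equivalence \<sigma> F F' \<longleftrightarrow>
     bij \<sigma> \<and> (\<forall>I. (\<Inter>i\<in>I. F i) \<noteq> {} \<longleftrightarrow> (\<Inter>i\<in>I. F' (\<sigma> i)) \<noteq> {})"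

definition product_facet ::
  "('m::finite \<Rightarrow> 'b::euclidean_space) \<Rightarrow> real ^ 'm \<Rightarrow>
   ('k::finite \<Rightarrow> 'c::euclidean_space) \<Rightarrow> real ^ 'k \<Rightarrow> 'm + 'k \<Rightarrow> ('b \<times> 'c) set" where
  "product_facet \<eta>1 \<kappa>1 \<eta>2 \<kappa>2 f = (case f of
       Inl j \<Rightarrow> poly_facet \<eta>1 \<kappa>1 j \<times> poly_set \<eta>2 \<kappa>2
     | Inr i \<Rightarrow> poly_set \<eta>1 \<kappa>1 \<times> poly_facet \<eta>2 \<kappa>2 i)"

text \<open>
  \<open>bundle_via \<sigma> \<eta> \<kappa> \<eta>1 \<kappa>1 \<eta>2 \<kappa>2\<close>: the polytope \<open>(\<eta>, \<kappa>)\<close> is a bundle with fibre \<open>(\<eta>1, \<kappa>1)\<close> over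
  \<open>(\<eta>2, \<kappa>2)\<close>, where \<open>\<sigma>\<close> matches the facets of the product with those of the total space:
  \<open>\<sigma> (Inl j)\<close> are the fibre facets and \<open>\<sigma> (Inr i)\<close> the base facets. Conormals are compared up
  to positive multiples.
\<close>

definition bundle_via ::
  "('m + 'k \<Rightarrow> 'n) \<Rightarrow>
   ('n::finite \<Rightarrow> 'a::euclidean_space) \<Rightarrow> real ^ 'n \<Rightarrow>
   ('m::finite \<Rightarrow> 'b::euclidean_space) \<Rightarrow> real ^ 'm \<Rightarrow>
   ('k::finite \<Rightarrow> 'c::euclidean_space) \<Rightarrow> real ^ 'k \<Rightarrow> bool" where
  "bundle_via \<sigma> \<eta> \<kappa> \<eta>1 \<kappa>1 \<eta>2 \<kappa>2 \<longleftrightarrow>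
     simple_polytope \<eta>1 \<kappa>1 \<and> simple_polytope \<eta>2 \<kappa>2 \<and>
     combinatorial_equivalence \<sigma> (product_facet \<eta>1 \<kappa>1 \<eta>2 \<kappa>2) (poly_facet \<eta> \<kappa>) \<and>
     (\<exists>\<iota> \<pi>. linear \<iota> \<and> linear \<pi> \<and> inj \<iota> \<and> surj \<pi> \<and> range \<iota> = {x. \<pi> x = 0} \<and>
        (\<forall>j. \<exists>s>0. s *\<^sub>R \<eta> (\<sigma> (Inl j)) = \<iota> (\<eta>1 j)) \<and>
        (\<forall>i. \<exists>s>0. \<pi> (s *\<^sub>R \<eta> (\<sigma> (Inr i))) = \<eta>2 i))"

definition symmetry_with_linear_part ::
  "'a::euclidean_space set \<Rightarrow> ('a \<Rightarrow> 'a) \<Rightarrow> ('a \<Rightarrow> 'a) \<Rightarrow> bool" where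
  "symmetry_with_linear_part S A f \<longleftrightarrow>
     linear A \<and> (\<exists>c. \<forall>x. f x = A x + c) \<and> f ` S = S"

definition robust_symmetry ::
  "('n::finite \<Rightarrow> 'a::euclidean_space) \<Rightarrow> real ^ 'n \<Rightarrow> ('a \<Rightarrow> 'a) \<Rightarrow> bool" where
  "robust_symmetry \<eta> \<kappa> A \<longleftrightarrow>
     linear A \<and>
     (\<forall>\<kappa>' \<in> chamber \<eta> \<kappa>. \<exists>f. symmetry_with_linear_part (poly_set \<eta> \<kappa>') A f)"

text \<open>
  A symmetry of a polytope fixes its centre of mass and is therefore determined by its linear
  part; hence the quantifier over \<open>f\<close> below ranges over a single map for each \<open>\<kappa>'\<close>.
\<close>

definition facets_equivalent ::
  "('n::finite \<Rightarrow> 'a::euclidean_space) \<Rightarrow> real ^ 'n \<Rightarrow> 'n \<Rightarrow> 'n \<Rightarrow> bool" where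
  "facets_equivalent \<eta> \<kappa> i j \<longleftrightarrow>
     (\<exists>A. robust_symmetry \<eta> \<kappa> A \<and>
        (\<forall>\<kappa>' \<in> chamber \<eta> \<kappa>. \<forall>f. symmetry_with_linear_part (poly_set \<eta> \<kappa>') A f \<longrightarrow>
           f ` poly_facet \<eta> \<kappa>' i = poly_facet \<eta> \<kappa>' j))"

text \<open>
  \<open>\<nu>\<close> is a rescaling of the conormals \<open>\<eta>\<close> that is compatible with all robust symmetries. Robust
  symmetries and equivalence of facets only involve the family of polytopes \<open>\<Delta>(\<kappa>')\<close> in the
  chamber, which as a family of subsets is unaffected by rescaling, so they can be taken with
  respect to \<open>\<eta>\<close>.
\<close>

definition normalized_conormals ::
  "('n::finite \<Rightarrow> 'a::euclidean_space) \<Rightarrow> real ^ 'n \<Rightarrow> ('n \<Rightarrow> 'a) \<Rightarrow> bool" where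
  "normalized_conormals \<eta> \<kappa> \<nu> \<longleftrightarrow>
     (\<forall>i. \<exists>s>0. \<nu> i = s *\<^sub>R \<eta> i) \<and>
     (\<forall>A. robust_symmetry \<eta> \<kappa> A \<longrightarrow> (\<forall>i. \<exists>j. adjoint A (\<nu> i) = \<nu> j))"

text \<open>
  Normalized conormals always exist, and two choices differ by a constant factor on each
  equivalence class, so the property below does not depend on the choice of \<open>\<nu>\<close>.
\<close>

definition inessential ::
  "('n::finite \<Rightarrow> 'a::euclidean_space) \<Rightarrow> real ^ 'n \<Rightarrow> 'a \<Rightarrow> bool" where
  "inessential \<eta> \<kappa> H \<longleftrightarrow>
     (\<exists>\<nu> \<beta>. normalized_conormals \<eta> \<kappa> \<nu> \<and>
        H = (\<Sum>i\<in>UNIV. \<beta> i *\<^sub>R \<nu> i) \<and>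
        (\<forall>I \<in> UNIV // {(i, j). facets_equivalent \<eta> \<kappa> i j}. (\<Sum>i\<in>I. \<beta> i) = 0))"

end

theory Submission
  imports Defs
begin

text \<open>
  Moving one facet inwards cuts a strip off the polygon. If two facets \<open>i\<close> and \<open>j\<close> do not meet, small
  strips along them are disjoint, so area and first moment are additive: their mixed second
  differences vanish. The first moment of \<open>H\<close> is the area times \<open>\<Sum> \<gamma> m \<kappa> m + C\<close>, and comparing the
  differences gives \<open>m\<^sub>i(s) \<gamma> j t + m\<^sub>j(t) \<gamma> i s = 0\<close>, where \<open>m\<^sub>i(s)\<close> is the area of the strip of width \<open>s\<close>
  along \<open>i\<close> (\<open>disjoint_facets_relation\<close>). Hence \<open>\<gamma> i\<close> and \<open>\<gamma> j\<close> vanish together, and if they do not vanish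
  then \<open>m\<^sub>i\<close> is linear. A strip is a trapezoid bounded by the two neighbours of its facet, so linearity
  means that these neighbours are parallel (\<open>neighbours_parallel\<close>).

  Translations show that \<open>H = \<Sum> \<gamma> m \<eta> m\<close>, so some \<open>\<gamma> i\<close> is nonzero. Unless the polygon is a
  triangle, some facet does not meet \<open>i\<close>, so the neighbours \<open>k\<close> and \<open>l\<close> of \<open>i\<close> are parallel. The same
  applies to the facet \<open>j\<close> on the other side of \<open>k\<close>, and this closes the polygon up to a quadrilateral
  (\<open>quadrilateral\<close>). If the parallel edges are symmetric, the other two are the base facets of a
  bundle; otherwise they have parallel neighbours too and the quadrilateral is a parallelogram. In a
  triangle two edges cannot both be symmetric, because \<open>H\<close> would be a multiple of one conormal \<open>\<eta> l\<close>,
  and shrinking the triangle to a point of the facet \<open>l\<close> would force the center of mass onto that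
  facet (\<open>ex_second_coefficient\<close>).

  For inessentiality, whenever some direction \<open>w\<close> is killed by all conormals except \<open>\<eta> i\<close> and \<open>\<eta> j\<close>,
  on which it is positive and negative, the affine reflection along \<open>w\<close> is a robust symmetry that
  exchanges \<open>i\<close> and \<open>j\<close> (\<open>swap_symmetry\<close>). In a quadrilateral whose edges other than \<open>i\<close> and \<open>j\<close> are
  parallel, cutting strips of corresponding widths along \<open>i\<close> or along \<open>j\<close> gives translates of the same
  polygon, so the two strips have equal area and the relation above makes the coefficients cancel. In a triangle all edges are equivalent and the
  normalized conormals sum to zero, so the coefficients can be shifted to have sum zero.
  Normalized conormals exist because every symmetry fixes the mean of the vertices
  (\<open>ex_normalized_conormals\<close>).
\<close>

section \<open>Integrals over compact sets\<close>

lemma compact_set_integrable: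
  fixes f :: "'a::euclidean_space \<Rightarrow> 'b::euclidean_space"
  assumes "compact S" "continuous_on S f"
  shows "f integrable_on S" "integral S f = (LINT x|lborel. indicator S x *\<^sub>R f x)"
proof -
  have "set_integrable lborel S f"
    using borel_integrable_compact[OF assms] by (simp add: set_integrable_def)
  then show "f integrable_on S" "integral S f = (LINT x|lborel. indicator S x *\<^sub>R f x)"
    using set_borel_integral_eq_integral[of S f] by (auto simp: set_lebesgue_integral_def)
qed

lemma integral_translate_compact:
  fixes f :: "'a::euclidean_space \<Rightarrow> 'b::euclidean_space"
  assumes "compact S" "continuous_on UNIV f"
  shows "integral ((+) t ` S) f = integral S (\<lambda>x. f (t + x))"
proof -
  have f: "f \<in> borel_measurable borel"
    using assms(2) by (simp add: borel_measurable_continuous_onI)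
  have S: "(+) t ` S \<in> sets borel"
    using assms(1) by (simp add: compact_translation borel_compact)
  have c: "continuous_on S (\<lambda>x. f (t + x))"
    by (rule continuous_on_compose2[OF assms(2)]) (auto intro!: continuous_intros)
  have "integral ((+) t ` S) f = (LINT x|lborel. indicator ((+) t ` S) x *\<^sub>R f x)"
    using assms compact_set_integrable(2)[of "(+) t ` S" f]
    by (simp add: compact_translation continuous_on_subset)
  also have "\<dots> = (LINT x|distr lborel borel ((+) t). indicator ((+) t ` S) x *\<^sub>R f x)"
    by (simp add: lborel_distr_plus)
  also have "\<dots> = (LINT x|lborel. indicator ((+) t ` S) (t + x) *\<^sub>R f (t + x))"
    using f S by (subst integral_distr) auto
  also have "\<dots> = (LINT x|lborel. indicator S x *\<^sub>R f (t + x))"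
    by (intro Bochner_Integration.integral_cong) (auto simp: indicator_def)
  also have "\<dots> = integral S (\<lambda>x. f (t + x))"
    using compact_set_integrable(2)[OF assms(1) c] by simp
  finally show ?thesis .
qed

lemma measure_compact_eq_integral:
  fixes S :: "'a::euclidean_space set"
  assumes "compact S"
  shows "measure lebesgue S = integral S (\<lambda>x. 1)"
  by (rule lmeasure_integral) (simp add: assms lmeasurable_compact)

text \<open>Stated for sets that may overlap, which avoids half-open pieces when a polygon is cut.\<close>

lemma integral_inclusion_exclusion:
  fixes f :: "'a::euclidean_space \<Rightarrow> 'b::euclidean_space"
  assumes "compact A" "compact B" "continuous_on UNIV f"
  shows "integral (A \<union> B) f + integral (A \<inter> B) f = integral A f + integral B f"
proof -
  let ?g = "\<lambda>S x. if x \<in> S then f x else 0"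
  have i: "?g S integrable_on UNIV" if "compact S" for S
    using compact_set_integrable(1)[OF that] assms(3) continuous_on_subset
    by (subst integrable_restrict_UNIV) blast
  have "integral (A \<union> B) f + integral (A \<inter> B) f
      = integral UNIV (?g (A \<union> B)) + integral UNIV (?g (A \<inter> B))"
    by (simp only: integral_restrict_UNIV)
  also have "\<dots> = integral UNIV (\<lambda>x. ?g (A \<union> B) x + ?g (A \<inter> B) x)"
    by (intro Henstock_Kurzweil_Integration.integral_add[symmetric] i compact_Un compact_Int assms)
  also have "\<dots> = integral UNIV (\<lambda>x. ?g A x + ?g B x)"
    by (intro Henstock_Kurzweil_Integration.integral_cong) auto
  also have "\<dots> = integral UNIV (?g A) + integral UNIV (?g B)"
    by (intro Henstock_Kurzweil_Integration.integral_add i assms)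
  also have "\<dots> = integral A f + integral B f"
    by (simp only: integral_restrict_UNIV)
  finally show ?thesis .
qed

lemma measure_compact_pos:
  fixes S :: "'a::euclidean_space set"
  assumes "compact S" "open U" "U \<noteq> {}" "U \<subseteq> S"
  shows "measure lebesgue S > 0"
proof -
  have "\<not> negligible S"
    using assms open_not_negligible negligible_subset by blast
  then have "measure lebesgue S \<noteq> 0"
    using assms(1) negligible_iff_measure0 lmeasurable_compact by blast
  then show ?thesis
    using measure_nonneg[of lebesgue S] by linarith
qed

lemma measure_compact_strict_mono:
  fixes A B :: "'a::euclidean_space set"
  assumes "compact A" "compact B" "A \<subseteq> B" "open U" "U \<noteq> {}" "U \<subseteq> B - A"
  shows "measure lebesgue A < measure lebesgue B"
proof -
  have m: "A \<in> lmeasurable" "B \<in> lmeasurable"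
    using assms by (auto simp: lmeasurable_compact)
  have "\<not> negligible (B - A)"
    using assms open_not_negligible negligible_subset by blast
  then have "measure lebesgue (B - A) \<noteq> 0"
    using m by (simp add: negligible_iff_measure0 fmeasurable.Diff)
  then show ?thesis
    using measurable_measure_Diff[of B lebesgue A] m assms(3) measure_nonneg[of lebesgue "B - A"]
      fmeasurableD by fastforce
qed

lemma measure_split_hyperplane:
  fixes P :: "'a::euclidean_space set"
  assumes "compact P" "a \<noteq> 0"
  shows "measure lebesgue P
    = measure lebesgue (P \<inter> {x. a \<bullet> x \<le> c}) + measure lebesgue (P \<inter> {x. c \<le> a \<bullet> x})"
proof -
  let ?A = "P \<inter> {x. a \<bullet> x \<le> c}" and ?B = "P \<inter> {x. c \<le> a \<bullet> x}"
  have c: "compact ?A" "compact ?B"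
    using assms by (auto intro!: compact_Int_closed closed_halfspace_le closed_halfspace_ge)
  have "?A \<inter> ?B \<subseteq> {x. a \<bullet> x = c}" by auto
  then have "negligible (?A \<inter> ?B)"
    using negligible_hyperplane[of a c] assms(2) negligible_subset by blast
  then have 0: "measure lebesgue (?A \<inter> ?B) = 0"
    by (simp add: negligible_imp_measure0)
  have "?A \<union> ?B = P" by auto
  then show ?thesis
    using integral_inclusion_exclusion[OF c, of "\<lambda>x. 1::real"] c 0 assms(1)
    by (simp add: measure_compact_eq_integral compact_Int)
qed

lemma center_of_mass_integral:
  assumes "measure lebesgue S \<noteq> 0"
  shows "integral S (\<lambda>x. x) = measure lebesgue S *\<^sub>R center_of_mass S"
  using assms by (simp add: center_of_mass_def)

lemma center_of_mass_translate:
  fixes S :: "'a::euclidean_space set"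
  assumes "compact S" "measure lebesgue S \<noteq> 0"
  shows "center_of_mass ((+) t ` S) = t + center_of_mass S"
proof -
  have m: "measure lebesgue ((+) t ` S) = measure lebesgue S"
    by (rule measure_translation)
  have "integral ((+) t ` S) (\<lambda>x. x) = integral S (\<lambda>x. t + x)"
    by (rule integral_translate_compact[OF assms(1)]) simp
  also have "\<dots> = integral S (\<lambda>x. t) + integral S (\<lambda>x. x)"
    by (intro Henstock_Kurzweil_Integration.integral_add compact_set_integrable(1) assms(1)
        continuous_intros)
  also have "integral S (\<lambda>x. t) = measure lebesgue S *\<^sub>R t"
    using integral_linear[of "\<lambda>x. 1::real" S "\<lambda>r. r *\<^sub>R t"]
      compact_set_integrable(1)[OF assms(1), of "\<lambda>x. 1::real"] bounded_linear_scaleR_left[of t]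
    by (simp add: o_def measure_compact_eq_integral[OF assms(1)])
  finally show ?thesis
    using assms(2) by (simp add: center_of_mass_def m scaleR_right_distrib)
qed

lemma inner_integral_compact:
  fixes S :: "'a::euclidean_space set"
  assumes "compact S"
  shows "H \<bullet> integral S (\<lambda>x. x) = integral S (\<lambda>x. H \<bullet> x)"
  using integral_linear[of "\<lambda>x. x" S "\<lambda>x. H \<bullet> x"] compact_set_integrable(1)[OF assms, of "\<lambda>x. x"]
    bounded_linear_inner_right[of H] by (simp add: o_def)

lemma center_of_mass_ge:
  fixes S :: "'a::euclidean_space set"
  assumes "compact S" "measure lebesgue S > 0" "\<And>x. x \<in> S \<Longrightarrow> a \<bullet> x \<ge> b"
  shows "a \<bullet> center_of_mass S \<ge> b"
proof -
  have "b * measure lebesgue S = integral S (\<lambda>x. b)"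
    using integral_mult_right[of S b "\<lambda>x. 1"] by (simp add: measure_compact_eq_integral[OF assms(1)])
  also have "\<dots> \<le> integral S (\<lambda>x. a \<bullet> x)"
    by (intro integral_le compact_set_integrable(1) assms continuous_intros)
  also have "\<dots> = measure lebesgue S * (a \<bullet> center_of_mass S)"
    using center_of_mass_integral[of S] assms(2) inner_integral_compact[OF assms(1), of a] by simp
  finally show ?thesis
    using assms(2) by (simp add: mult.commute)
qed

text \<open>The open set \<open>U\<close> is a part of \<open>S\<close> of positive measure on which \<open>a \<bullet> x\<close> stays below \<open>b\<close> by at
  least \<open>s\<close>.\<close>

lemma center_of_mass_less:
  fixes S :: "'a::euclidean_space set"
  assumes "compact S" "open U" "U \<noteq> {}" "U \<subseteq> S" "\<And>x. x \<in> S \<Longrightarrow> a \<bullet> x \<le> b"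
    and "U \<subseteq> {x. a \<bullet> x < b - s}" "s > 0"
  shows "a \<bullet> center_of_mass S < b"
proof -
  let ?E = "S \<inter> {x. a \<bullet> x \<le> b - s}"
  have E: "compact ?E"
    using assms(1) by (intro compact_Int_closed closed_halfspace_le)
  have mE: "measure lebesgue ?E > 0"
    by (rule measure_compact_pos[OF E assms(2,3)]) (use assms(4,6) in auto)
  have mS: "measure lebesgue S > 0"
    by (rule measure_compact_pos[OF assms(1-4)])
  have "s * measure lebesgue ?E = integral ?E (\<lambda>x. s)"
    using integral_mult_right[of ?E s "\<lambda>x. 1"] by (simp add: measure_compact_eq_integral[OF E])
  also have "\<dots> \<le> integral ?E (\<lambda>x. b - a \<bullet> x)"
    by (intro integral_le compact_set_integrable(1) E continuous_intros) auto
  also have "\<dots> \<le> integral S (\<lambda>x. b - a \<bullet> x)"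
    using assms(5) by (intro integral_subset_le compact_set_integrable(1) E assms(1) continuous_intros) auto
  also have "\<dots> = integral S (\<lambda>x. b) - integral S (\<lambda>x. a \<bullet> x)"
    by (intro Henstock_Kurzweil_Integration.integral_diff compact_set_integrable(1) assms(1) continuous_intros)
  also have "\<dots> = b * measure lebesgue S - measure lebesgue S * (a \<bullet> center_of_mass S)"
    using center_of_mass_integral[of S] mS inner_integral_compact[OF assms(1), of a]
      integral_mult_right[of S b "\<lambda>x. 1"] by (simp add: measure_compact_eq_integral[OF assms(1)])
  finally have "0 < measure lebesgue S * (b - a \<bullet> center_of_mass S)"
    using mult_pos_pos[OF assms(7) mE] by (simp add: right_diff_distrib mult.commute)
  then show ?thesis
    using mS by (simp add: zero_less_mult_iff)
qed

section \<open>Polygons described by their tight constraints\<close>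

text \<open>In the plane, two vectors orthogonal to the same nonzero vector are parallel.\<close>

lemma perp_multiple_dim2:
  fixes u v w :: "'a::euclidean_space"
  assumes "DIM('a) = 2" "w \<noteq> 0" "u \<noteq> 0" "u \<bullet> w = 0" "v \<bullet> w = 0"
  shows "\<exists>c. v = c *\<^sub>R u"
proof -
  have "span {u} = {x. w \<bullet> x = 0}"
  proof (rule subspace_dim_equal)
    show "subspace (span {u})" "subspace {x. w \<bullet> x = 0}"
      by (auto simp: subspace_hyperplane)
    show "span {u} \<subseteq> {x. w \<bullet> x = 0}"
      using assms(4) by (auto simp: span_singleton inner_commute)
    have "dim (span {u}) = 1"
      using assms(3) by (simp add: dim_span dim_insert)
    then show "dim {x. w \<bullet> x = 0} \<le> dim (span {u})"
      using assms(1,2) by (simp add: dim_hyperplane)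
  qed
  then have "v \<in> span {u}"
    using assms(5) by (simp add: inner_commute)
  then show ?thesis
    by (auto simp: span_singleton)
qed

lemma poly_set_iff: "x \<in> poly_set \<eta> \<kappa> \<longleftrightarrow> (\<forall>i. \<eta> i \<bullet> x \<le> \<kappa> $ i)"
  by (auto simp: poly_set_def)

lemma poly_facet_iff: "x \<in> poly_facet \<eta> \<kappa> i \<longleftrightarrow> x \<in> poly_set \<eta> \<kappa> \<and> \<eta> i \<bullet> x = \<kappa> $ i"
  by (auto simp: poly_facet_def)

lemma convex_poly_set: "convex (poly_set \<eta> \<kappa>)"
  unfolding poly_set_def by (intro convex_INT convex_halfspace_le)

lemma closed_poly_set: "closed (poly_set \<eta> \<kappa>)"
  unfolding poly_set_def by (intro closed_INT closed_halfspace_le ballI)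

lemma polyhedron_poly_set: "polyhedron (poly_set \<eta> \<kappa>)"
  unfolding poly_set_def by (intro polyhedron_Inter) (auto simp: polyhedron_halfspace_le)

lemma poly_facet_face_of: "poly_facet \<eta> \<kappa> i face_of poly_set \<eta> \<kappa>"
  unfolding poly_facet_def
  by (rule face_of_Int_supporting_hyperplane_le[OF convex_poly_set]) (simp add: poly_set_iff)

lemma open_strict_constraints:
  fixes \<eta> :: "'n::finite \<Rightarrow> 'a::euclidean_space"
  shows "open {x. \<forall>i\<in>I. \<eta> i \<bullet> x < \<kappa> $ i}"
proof -
  have "{x. \<forall>i\<in>I. \<eta> i \<bullet> x < \<kappa> $ i} = (\<Inter>i\<in>I. {x. \<eta> i \<bullet> x < \<kappa> $ i})" by auto
  then show ?thesis by (auto intro!: open_INT open_halfspace_lt)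
qed

text \<open>A direction along which all tight constraints are constant stays in the polytope for a short
  while, both forwards and backwards.\<close>

lemma poly_set_segment_through:
  fixes \<eta> :: "'n::finite \<Rightarrow> 'a::euclidean_space"
  assumes "v \<in> poly_set \<eta> \<kappa>" "\<And>i. \<eta> i \<bullet> v = \<kappa> $ i \<Longrightarrow> \<eta> i \<bullet> w = 0"
  obtains e where "e > 0" "v + e *\<^sub>R w \<in> poly_set \<eta> \<kappa>" "v - e *\<^sub>R w \<in> poly_set \<eta> \<kappa>"
proof -
  let ?U = "{x. \<forall>i\<in>{i. \<eta> i \<bullet> v < \<kappa> $ i}. \<eta> i \<bullet> x < \<kappa> $ i}"
  obtain r where r: "r > 0" "ball v r \<subseteq> ?U"
    by (rule openE[OF open_strict_constraints, of v "{i. \<eta> i \<bullet> v < \<kappa> $ i}" \<eta> \<kappa>]) auto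
  define e where "e = r / (norm w + 1)"
  have n: "norm w + 1 > 0"
    by (simp add: add_nonneg_pos)
  have e: "e > 0" "norm (e *\<^sub>R w) < r"
    using r(1) n by (simp_all add: e_def pos_divide_less_eq)
  have in_P: "x \<in> poly_set \<eta> \<kappa>" if x: "x \<in> ?U" "\<And>i. \<eta> i \<bullet> v = \<kappa> $ i \<Longrightarrow> \<eta> i \<bullet> x = \<kappa> $ i" for x
  proof -
    have "\<eta> i \<bullet> x \<le> \<kappa> $ i" for i
    proof (cases "\<eta> i \<bullet> v = \<kappa> $ i")
      case False
      then have "\<eta> i \<bullet> v < \<kappa> $ i"
        using assms(1) by (simp add: poly_set_iff order_less_le)
      then show ?thesis using x(1) by (auto intro: less_imp_le)
    qed (simp add: x(2))
    then show ?thesis by (simp add: poly_set_iff)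
  qed
  have "v + e *\<^sub>R w \<in> poly_set \<eta> \<kappa>"
  proof (rule in_P)
    show "v + e *\<^sub>R w \<in> ?U"
      using e(2) by (intro subsetD[OF r(2)]) (simp add: dist_norm)
  qed (simp add: inner_add_right assms(2))
  moreover have "v - e *\<^sub>R w \<in> poly_set \<eta> \<kappa>"
  proof (rule in_P)
    show "v - e *\<^sub>R w \<in> ?U"
      using e(2) by (intro subsetD[OF r(2)]) (simp add: dist_norm)
  qed (simp add: inner_diff_right assms(2))
  ultimately show thesis using that e(1) by blast
qed

lemma not_extreme_if_tight_perp:
  fixes \<eta> :: "'n::finite \<Rightarrow> 'a::euclidean_space"
  assumes "v \<in> poly_set \<eta> \<kappa>" "w \<noteq> 0" "\<And>i. \<eta> i \<bullet> v = \<kappa> $ i \<Longrightarrow> \<eta> i \<bullet> w = 0"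
  shows "\<not> v extreme_point_of poly_set \<eta> \<kappa>"
proof -
  obtain e where e: "e > 0" "v + e *\<^sub>R w \<in> poly_set \<eta> \<kappa>" "v - e *\<^sub>R w \<in> poly_set \<eta> \<kappa>"
    using poly_set_segment_through[OF assms(1,3)] by blast
  have "v = midpoint (v + e *\<^sub>R w) (v - e *\<^sub>R w)"
    by (simp add: midpoint_def scaleR_2[symmetric])
  moreover have "v + e *\<^sub>R w \<noteq> v - e *\<^sub>R w"
  proof
    assume "v + e *\<^sub>R w = v - e *\<^sub>R w"
    then have "(v + e *\<^sub>R w) \<bullet> w = (v - e *\<^sub>R w) \<bullet> w" by (rule arg_cong)
    then have "e * (w \<bullet> w) = 0" by (simp add: inner_add_left inner_diff_left)
    then show False using e(1) assms(2) by simp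
  qed
  ultimately have "v \<in> open_segment (v + e *\<^sub>R w) (v - e *\<^sub>R w)"
    by (metis midpoint_in_open_segment)
  then show ?thesis
    using e unfolding extreme_point_of_def by blast
qed

text \<open>A linear functional that attains its maximum over a segment in the open segment is constant
  along it.\<close>

lemma tight_open_segment:
  fixes a :: "'a::euclidean_space"
  assumes "x \<in> open_segment p q" "a \<bullet> p \<le> b" "a \<bullet> q \<le> b" "a \<bullet> x = b"
  shows "a \<bullet> p = b" "a \<bullet> q = b"
proof -
  obtain u where u: "0 < u" "u < 1" "x = (1 - u) *\<^sub>R p + u *\<^sub>R q"
    using assms(1) by (auto simp: in_segment)
  have eq: "(1 - u) * (b - a \<bullet> p) + u * (b - a \<bullet> q) = 0"
    using assms(4) by (simp add: u(3) inner_add_right algebra_simps)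
  have "(1 - u) * (b - a \<bullet> p) \<ge> 0" "u * (b - a \<bullet> q) \<ge> 0"
    using assms u by auto
  then have "(1 - u) * (b - a \<bullet> p) = 0" "u * (b - a \<bullet> q) = 0"
    using eq by linarith+
  then show "a \<bullet> p = b" "a \<bullet> q = b" using u by auto
qed

text \<open>Simplicity of a polygon in terms of constraints only: this form is visibly stable under small
  changes of the support numbers.\<close>

locale polygon =
  fixes \<eta> :: "'n::finite \<Rightarrow> 'a::euclidean_space" and \<kappa> :: "real ^ 'n"
  assumes dim2: "DIM('a) = 2"
    and bounded_poly: "bounded (poly_set \<eta> \<kappa>)"
    and strict_point: "\<exists>x. \<forall>i. \<eta> i \<bullet> x < \<kappa> $ i"
    and facet_point: "\<exists>y. \<eta> i \<bullet> y = \<kappa> $ i \<and> (\<forall>j. j \<noteq> i \<longrightarrow> \<eta> j \<bullet> y < \<kappa> $ j)"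
    and conormal_nonzero: "\<eta> i \<noteq> 0"
    and card_tight: "x \<in> poly_set \<eta> \<kappa> \<Longrightarrow> card {i. \<eta> i \<bullet> x = \<kappa> $ i} \<le> 2"
begin

abbreviation "P \<equiv> poly_set \<eta> \<kappa>"
abbreviation "F \<equiv> poly_facet \<eta> \<kappa>"

lemma compact_poly: "compact P"
  by (simp add: bounded_poly closed_poly_set compact_eq_bounded_closed)

lemma compact_facet: "compact (F i)"
  unfolding poly_facet_def by (intro compact_Int_closed compact_poly closed_hyperplane)

lemma convex_facet: "convex (F i)"
  unfolding poly_facet_def by (intro convex_Int convex_poly_set convex_hyperplane)

lemma interior_subset: "{x. \<forall>i. \<eta> i \<bullet> x < \<kappa> $ i} \<subseteq> P"
  by (auto simp: poly_set_iff less_imp_le)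

lemma open_interior: "open {x. \<forall>i. \<eta> i \<bullet> x < \<kappa> $ i}"
  using open_strict_constraints[of UNIV] by simp

lemma poly_nonempty: "P \<noteq> {}"
  using strict_point interior_subset by blast

lemma measure_poly_pos: "measure lebesgue P > 0"
  using measure_compact_pos[OF compact_poly open_interior] strict_point interior_subset by blast

lemma affine_hull_poly: "affine hull P = UNIV"
proof (rule affine_hull_nonempty_interior)
  show "interior P \<noteq> {}"
    using interior_maximal[OF interior_subset open_interior] strict_point by blast
qed

text \<open>Distinct facets never have the same outward direction.\<close>

lemma conormal_multiple_neg:
  assumes "i \<noteq> j" "\<eta> j = c *\<^sub>R \<eta> i"
  shows "c < 0"
proof (rule ccontr)
  assume "\<not> c < 0"
  moreover have "c \<noteq> 0"
    using conormal_nonzero[of j] assms(2) by auto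
  ultimately have c: "c > 0" by simp
  obtain y where y: "\<eta> i \<bullet> y = \<kappa> $ i" "\<eta> j \<bullet> y < \<kappa> $ j"
    using facet_point[of i] assms(1) by metis
  obtain z where z: "\<eta> j \<bullet> z = \<kappa> $ j" "\<eta> i \<bullet> z < \<kappa> $ i"
    using facet_point[of j] assms(1) by metis
  have "c * (\<eta> i \<bullet> z) < c * \<kappa> $ i"
    using z(2) c by simp
  then show False
    using y z by (simp add: assms(2))
qed

lemma antiparallel_facets_disjoint:
  assumes "\<eta> j = c *\<^sub>R \<eta> i" "c < 0"
  shows "F i \<inter> F j = {}"
proof -
  obtain z where z: "\<eta> i \<bullet> z < \<kappa> $ i" "\<eta> j \<bullet> z < \<kappa> $ j"
    using strict_point by blast
  have "c * (\<eta> i \<bullet> z) > c * \<kappa> $ i"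
    using z(1) assms(2) by simp
  then show ?thesis
    using z(2) assms(1) by (auto simp: poly_facet_iff)
qed

lemma meeting_facets_not_parallel:
  assumes "i \<noteq> j" "F i \<inter> F j \<noteq> {}"
  shows "\<eta> j \<noteq> c *\<^sub>R \<eta> i"
  using assms conormal_multiple_neg antiparallel_facets_disjoint by metis

lemma meeting_facets_separate:
  assumes "i \<noteq> j" "F i \<inter> F j \<noteq> {}" "\<eta> i \<bullet> w = 0" "\<eta> j \<bullet> w = 0"
  shows "w = 0"
  using perp_multiple_dim2[OF dim2, of w "\<eta> i" "\<eta> j"] meeting_facets_not_parallel[OF assms(1,2)]
    assms(3,4) conormal_nonzero by blast

lemma aff_dim_facet: "aff_dim (F i) = int DIM('a) - 1"
proof (rule antisym)
  let ?H = "{x. \<eta> i \<bullet> x = \<kappa> $ i}" and ?U = "{x. \<forall>j\<in>- {i}. \<eta> j \<bullet> x < \<kappa> $ j}"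
  have H: "aff_dim ?H = int DIM('a) - 1"
    using conormal_nonzero by simp
  have "F i \<subseteq> ?H" by (auto simp: poly_facet_iff)
  then have "aff_dim (F i) \<le> aff_dim ?H" by (rule aff_dim_subset)
  then show "aff_dim (F i) \<le> int DIM('a) - 1" using H by simp
  obtain y where "\<eta> i \<bullet> y = \<kappa> $ i" "\<forall>j. j \<noteq> i \<longrightarrow> \<eta> j \<bullet> y < \<kappa> $ j"
    using facet_point[of i] by blast
  then have "y \<in> ?H \<inter> ?U"
    by simp
  then have "?H \<inter> ?U \<noteq> {}"
    by blast
  then have "affine hull (?H \<inter> ?U) = affine hull ?H"
    by (rule affine_hull_affine_Int_open[OF affine_hyperplane open_strict_constraints])
  then have "aff_dim (?H \<inter> ?U) = int DIM('a) - 1"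
    using H aff_dim_affine_hull[of ?H] aff_dim_affine_hull[of "?H \<inter> ?U"] by argo
  moreover have "?H \<inter> ?U \<subseteq> F i"
  proof
    fix x assume x: "x \<in> ?H \<inter> ?U"
    have "\<eta> j \<bullet> x \<le> \<kappa> $ j" for j
      using x by (cases "j = i") (auto intro: less_imp_le)
    then show "x \<in> F i" using x by (simp add: poly_facet_iff poly_set_iff)
  qed
  then have "aff_dim (?H \<inter> ?U) \<le> aff_dim (F i)" by (rule aff_dim_subset)
  ultimately show "int DIM('a) - 1 \<le> aff_dim (F i)" by simp
qed

lemma extreme_card_tight:
  assumes "v extreme_point_of P"
  shows "card {i. \<eta> i \<bullet> v = \<kappa> $ i} = 2"
proof (rule ccontr)
  assume "card {i. \<eta> i \<bullet> v = \<kappa> $ i} \<noteq> 2"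
  moreover have v: "v \<in> P"
    using assms by (simp add: extreme_point_of_def)
  ultimately have "card {i. \<eta> i \<bullet> v = \<kappa> $ i} \<le> 1"
    using card_tight[of v] by simp
  then have "\<forall>i j. \<eta> i \<bullet> v = \<kappa> $ i \<longrightarrow> \<eta> j \<bullet> v = \<kappa> $ j \<longrightarrow> i = j"
    by (simp add: card_le_Suc0_iff_eq)
  then obtain i where i: "{i. \<eta> i \<bullet> v = \<kappa> $ i} \<subseteq> {i}"
    by blast
  obtain w where w: "w \<noteq> 0" "\<eta> i \<bullet> w = 0"
    using orthogonal_to_vector_exists[of "\<eta> i"] dim2 by (auto simp: orthogonal_def)
  show False
    using not_extreme_if_tight_perp[OF v w(1)] i w(2) assms by blast
qed

lemma simple_polytope: "simple_polytope \<eta> \<kappa>"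
proof -
  have "{i. v \<in> F i} = {i. \<eta> i \<bullet> v = \<kappa> $ i}" if "v extreme_point_of P" for v
    using that by (auto simp: poly_facet_iff extreme_point_of_def)
  then show ?thesis
    using bounded_poly affine_hull_poly aff_dim_facet extreme_card_tight
    by (simp add: simple_polytope_def is_polytope_def dim2)
qed

end

lemma two_points_of_aff_dim_1:
  assumes "aff_dim S = 1"
  obtains a b where "a \<in> S" "b \<in> S" "a \<noteq> b"
proof -
  have "\<not> S \<subseteq> {a}" for a
    using aff_dim_subset[of S "{a}"] assms by auto
  moreover have "S \<noteq> {}"
    using assms by auto
  ultimately show thesis using that by blast
qed

text \<open>The substantial point is that two facets never share a line: otherwise a vertex on both would have no
  room for a third, transversal constraint.\<close>

lemma polygon_if_simple_polytope:
  fixes \<eta> :: "'n::finite \<Rightarrow> 'a::euclidean_space"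
  assumes dim2: "DIM('a) = 2" and simple: "simple_polytope \<eta> \<kappa>"
  shows "polygon \<eta> \<kappa>"
proof
  let ?P = "poly_set \<eta> \<kappa>" and ?F = "poly_facet \<eta> \<kappa>"
  show "DIM('a) = 2" by fact
  show bnd: "bounded ?P"
    using simple by (simp add: simple_polytope_def is_polytope_def)
  have hull: "affine hull ?P = UNIV"
    using simple by (simp add: simple_polytope_def is_polytope_def)
  have F1: "aff_dim (?F i) = 1" for i
    using simple dim2 by (simp add: simple_polytope_def is_polytope_def)
  have ext: "card {i. \<eta> i \<bullet> v = \<kappa> $ i} = 2" if "v extreme_point_of ?P" for v
  proof -
    have "{i. v \<in> ?F i} = {i. \<eta> i \<bullet> v = \<kappa> $ i}"
      using that by (auto simp: poly_facet_iff extreme_point_of_def)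
    moreover have "card {i. v \<in> ?F i} = 2"
      using simple that dim2 by (simp add: simple_polytope_def)
    ultimately show ?thesis by simp
  qed
  show nz: "\<eta> i \<noteq> 0" for i
  proof
    assume 0: "\<eta> i = 0"
    obtain a where "a \<in> ?F i"
      using two_points_of_aff_dim_1[OF F1] by metis
    then have "?F i = ?P"
      using 0 by (auto simp: poly_facet_iff)
    then have "aff_dim (affine hull ?P) = 1"
      using F1[of i] by simp
    then show False using hull dim2 by simp
  qed
  have "rel_interior ?P \<noteq> {}"
    using rel_interior_eq_empty[of ?P] convex_poly_set hull by (metis UNIV_not_empty affine_hull_empty)
  then obtain z where z: "z \<in> interior ?P"
    using rel_interior_interior[OF hull] by blast
  have zs: "\<eta> i \<bullet> z < \<kappa> $ i" for i
  proof -
    have "interior ?P \<subseteq> interior {x. \<eta> i \<bullet> x \<le> \<kappa> $ i}"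
      by (intro interior_mono) (auto simp: poly_set_iff)
    then show ?thesis using z nz by auto
  qed
  then show "\<exists>x. \<forall>i. \<eta> i \<bullet> x < \<kappa> $ i" by blast
  have not_pos: False if ij: "i \<noteq> j" "\<eta> j = c *\<^sub>R \<eta> i" "c > 0" for i j c
  proof -
    obtain a where a: "a \<in> ?F i" using two_points_of_aff_dim_1[OF F1] by metis
    obtain b where b: "b \<in> ?F j" using two_points_of_aff_dim_1[OF F1] by metis
    have "c * \<kappa> $ i \<le> \<kappa> $ j"
      using a ij(2) by (metis inner_scaleR_left poly_facet_iff poly_set_iff)
    moreover have "c * (\<eta> i \<bullet> b) \<le> c * \<kappa> $ i"
      using b ij(3) by (simp add: poly_facet_iff poly_set_iff)
    then have "\<kappa> $ j \<le> c * \<kappa> $ i"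
      using b ij(2) by (simp add: poly_facet_iff)
    ultimately have k: "\<kappa> $ j = c * \<kappa> $ i" by simp
    \<comment> \<open>The facets \<open>i\<close> and \<open>j\<close> coincide, so at a vertex of this facet only one direction is constrained.\<close>
    have "compact (?F i)"
      unfolding poly_facet_def
      by (intro compact_Int_closed closed_hyperplane) (simp add: bnd closed_poly_set compact_eq_bounded_closed)
    moreover have "convex (?F i)"
      unfolding poly_facet_def by (intro convex_Int convex_poly_set convex_hyperplane)
    ultimately obtain v where "v extreme_point_of ?F i"
      using extreme_point_exists_convex a by blast
    then have v: "v extreme_point_of ?P" "v \<in> ?F i"
      using extreme_point_of_face[OF poly_facet_face_of] by blast+
    have "{i, j} \<subseteq> {m. \<eta> m \<bullet> v = \<kappa> $ m}"
      using v(2) ij k by (simp add: poly_facet_iff)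
    then have T: "{m. \<eta> m \<bullet> v = \<kappa> $ m} = {i, j}"
      using card_subset_eq[of "{m. \<eta> m \<bullet> v = \<kappa> $ m}" "{i,j}"] ext[OF v(1)] ij(1) by simp
    obtain w where w: "w \<noteq> 0" "\<eta> i \<bullet> w = 0"
      using orthogonal_to_vector_exists[of "\<eta> i"] dim2 by (auto simp: orthogonal_def)
    have vP: "v \<in> ?P" using v(2) by (simp add: poly_facet_iff)
    have "\<eta> m \<bullet> w = 0" if "\<eta> m \<bullet> v = \<kappa> $ m" for m
    proof -
      have "m \<in> {i, j}" using that T by blast
      then show ?thesis using w(2) ij(2) by auto
    qed
    then show False
      using not_extreme_if_tight_perp[OF vP w(1)] v(1) by blast
  qed
  have not_par: "\<eta> j \<noteq> c *\<^sub>R \<eta> i"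
    if "i \<noteq> j" "\<eta> i \<bullet> x = \<kappa> $ i" "\<eta> j \<bullet> x = \<kappa> $ j" for i j c x
  proof
    assume eq: "\<eta> j = c *\<^sub>R \<eta> i"
    consider "c > 0" | "c = 0" | "c < 0" by linarith
    then show False
    proof cases
      case 3
      have "c * (\<eta> i \<bullet> z) > c * \<kappa> $ i"
        using zs[of i] 3 by simp
      then show False
        using zs[of j] that eq by simp
    qed (use not_pos[OF that(1) eq] eq nz[of j] in auto)
  qed
  have no_common_seg: False
    if "i \<noteq> j" "a \<noteq> b" "\<eta> i \<bullet> a = \<kappa> $ i" "\<eta> j \<bullet> a = \<kappa> $ j" "\<eta> i \<bullet> b = \<kappa> $ i" "\<eta> j \<bullet> b = \<kappa> $ j"
    for i j a b
  proof -
    have "\<exists>c. \<eta> j = c *\<^sub>R \<eta> i"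
      by (rule perp_multiple_dim2[OF dim2, of "b - a"]) (use that nz in \<open>auto simp: inner_diff_right\<close>)
    then show False using not_par[OF that(1,3,4)] by blast
  qed
  show "\<exists>y. \<eta> i \<bullet> y = \<kappa> $ i \<and> (\<forall>j. j \<noteq> i \<longrightarrow> \<eta> j \<bullet> y < \<kappa> $ j)" for i
  proof -
    obtain a b where ab: "a \<in> ?F i" "b \<in> ?F i" "a \<noteq> b"
      using two_points_of_aff_dim_1[OF F1] by metis
    have y: "\<eta> j \<bullet> midpoint a b = (\<eta> j \<bullet> a + \<eta> j \<bullet> b) / 2" for j
      by (simp add: midpoint_def inner_add_right)
    have "\<eta> j \<bullet> midpoint a b < \<kappa> $ j" if "j \<noteq> i" for j
    proof -
      have "\<eta> j \<bullet> a \<le> \<kappa> $ j" "\<eta> j \<bullet> b \<le> \<kappa> $ j" "\<eta> i \<bullet> a = \<kappa> $ i" "\<eta> i \<bullet> b = \<kappa> $ i"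
        using ab by (auto simp: poly_facet_iff poly_set_iff)
      moreover have "\<not> (\<eta> j \<bullet> a = \<kappa> $ j \<and> \<eta> j \<bullet> b = \<kappa> $ j)"
        using no_common_seg[of i j a b] that ab(3) calculation by auto
      ultimately show ?thesis by (simp add: y) linarith
    qed
    moreover have "\<eta> i \<bullet> midpoint a b = \<kappa> $ i"
      using ab by (simp add: y poly_facet_iff)
    ultimately show ?thesis by blast
  qed
  show "card {i. \<eta> i \<bullet> x = \<kappa> $ i} \<le> 2" if x: "x \<in> ?P" for x
  proof (cases "x extreme_point_of ?P")
    case False
    then obtain a b where ab: "a \<in> ?P" "b \<in> ?P" "x \<in> open_segment a b"
      using x unfolding extreme_point_of_def by blast
    have "a \<noteq> b" using ab(3) by auto
    have t: "\<eta> i \<bullet> a = \<kappa> $ i \<and> \<eta> i \<bullet> b = \<kappa> $ i" if "\<eta> i \<bullet> x = \<kappa> $ i" for i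
      using tight_open_segment[OF ab(3)] ab(1,2) that by (simp add: poly_set_iff)
    have "i = j" if "\<eta> i \<bullet> x = \<kappa> $ i" "\<eta> j \<bullet> x = \<kappa> $ j" for i j
      using no_common_seg[of i j a b] t[OF that(1)] t[OF that(2)] \<open>a \<noteq> b\<close> by blast
    then have "card {i. \<eta> i \<bullet> x = \<kappa> $ i} \<le> 1"
      by (simp add: card_le_Suc0_iff_eq)
    then show ?thesis by simp
  qed (simp add: ext)
qed

lemma simple_polytope_iff_polygon:
  fixes \<eta> :: "'n::finite \<Rightarrow> 'a::euclidean_space"
  assumes "DIM('a) = 2"
  shows "simple_polytope \<eta> \<kappa> \<longleftrightarrow> polygon \<eta> \<kappa>"
  using assms polygon.simple_polytope polygon_if_simple_polytope by blast

section \<open>Edges of a polygon\<close>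

context polygon
begin

text \<open>\<open>edge i k l p q\<close>: the facet \<open>i\<close> is the segment from \<open>p\<close> to \<open>q\<close>, where it meets its two
  neighbours \<open>k\<close> and \<open>l\<close>.\<close>

definition edge :: "'n \<Rightarrow> 'n \<Rightarrow> 'n \<Rightarrow> 'a \<Rightarrow> 'a \<Rightarrow> bool" where
  "edge i k l p q \<longleftrightarrow> i \<noteq> k \<and> i \<noteq> l \<and> k \<noteq> l \<and> p \<noteq> q \<and> F i = closed_segment p q \<and>
     F i \<inter> F k = {p} \<and> F i \<inter> F l = {q} \<and> (\<forall>m. m \<noteq> i \<longrightarrow> F i \<inter> F m \<noteq> {} \<longrightarrow> m = k \<or> m = l)"

text \<open>The end points of a facet are vertices, so exactly one further facet is tight at each of them.\<close>

lemma ex_edge: "\<exists>k l p q. edge i k l p q"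
proof -
  have F1: "aff_dim (F i) = 1"
    using aff_dim_facet dim2 by simp
  then have "F i \<noteq> {}" "collinear (F i)"
    by (auto simp: collinear_aff_dim)
  then obtain p q where pq: "F i = closed_segment p q"
    using compact_convex_collinear_segment[OF _ compact_facet convex_facet] by blast
  have ne: "p \<noteq> q"
  proof
    assume "p = q"
    then have "aff_dim (F i) = 0" using pq by simp
    then show False using F1 by simp
  qed
  have ext: "v extreme_point_of P" if "v \<in> {p, q}" for v
  proof -
    have "v extreme_point_of F i"
      using that by (simp add: pq extreme_point_of_segment)
    then show ?thesis
      using extreme_point_of_face[OF poly_facet_face_of] by blast
  qed
  have ends: "\<exists>k. k \<noteq> i \<and> {m. v \<in> F m} = {i, k}" if v: "v \<in> {p, q}" for v
  proof -
    have vi: "v \<in> F i" using v by (auto simp: pq)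
    then have "{m. v \<in> F m} = {m. \<eta> m \<bullet> v = \<kappa> $ m}"
      by (auto simp: poly_facet_iff)
    then have c: "card {m. v \<in> F m} = 2"
      using extreme_card_tight[OF ext[OF v]] by simp
    have "card ({m. v \<in> F m} - {i}) = 1"
      using c vi by (simp add: card_Diff_singleton)
    then obtain k where k: "{m. v \<in> F m} - {i} = {k}"
      by (auto simp: card_1_singleton_iff)
    have "i \<in> {m. v \<in> F m}" using vi by simp
    then have "k \<noteq> i \<and> {m. v \<in> F m} = {i, k}" using k by blast
    then show ?thesis by blast
  qed
  obtain k where k: "k \<noteq> i" "{m. p \<in> F m} = {i, k}" using ends[of p] by blast
  obtain l where l: "l \<noteq> i" "{m. q \<in> F m} = {i, l}" using ends[of q] by blast
  have one: False if "m \<noteq> i" "p \<in> F m" "q \<in> F m" for m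
  proof -
    have "p \<in> F i" "q \<in> F i" by (auto simp: pq)
    then have "F i \<inter> F m \<noteq> {}" "\<eta> i \<bullet> (q - p) = 0" "\<eta> m \<bullet> (q - p) = 0"
      using that by (auto simp: poly_facet_iff inner_diff_right)
    then have "q - p = 0"
      using meeting_facets_separate[of i m] that(1) by blast
    then show False using ne by simp
  qed
  have sub: "F i \<inter> F m \<subseteq> {p, q}" if m: "m \<noteq> i" for m
  proof
    fix x assume x: "x \<in> F i \<inter> F m"
    show "x \<in> {p, q}"
    proof (rule ccontr)
      assume "x \<notin> {p, q}"
      then have o: "x \<in> open_segment p q" using x pq by (auto simp: open_segment_def)
      have P: "p \<in> P" "q \<in> P" using pq by (auto simp: poly_facet_def)
      have le: "\<eta> m \<bullet> p \<le> \<kappa> $ m" "\<eta> m \<bullet> q \<le> \<kappa> $ m" "\<eta> m \<bullet> x = \<kappa> $ m"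
        using P x by (auto simp: poly_facet_iff poly_set_iff)
      have "p \<in> F m" "q \<in> F m"
        using tight_open_segment[OF o le] P by (auto simp: poly_facet_iff)
      then show False using one[OF m] by blast
    qed
  qed
  have "k \<noteq> l"
    using one[OF k(1)] k(2) l(2) by blast
  moreover have "F i \<inter> F k = {p}"
    using sub[OF k(1)] one[OF k(1)] k(2) pq by auto
  moreover have "F i \<inter> F l = {q}"
    using sub[OF l(1)] one[OF l(1)] l(2) pq by auto
  moreover have "m = k \<or> m = l" if m: "m \<noteq> i" "F i \<inter> F m \<noteq> {}" for m
  proof -
    obtain x where "x \<in> F i \<inter> F m" using m(2) by blast
    then have "p \<in> F m \<or> q \<in> F m" using sub[OF m(1)] by blast
    then show ?thesis using k l m(1) by blast
  qed
  ultimately show ?thesis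
    using k(1) l(1) ne pq unfolding edge_def by metis
qed

lemma edge_swap: "edge i k l p q \<Longrightarrow> edge i l k q p"
  unfolding edge_def closed_segment_commute[of q p] by blast

lemma ex_edge_from:
  assumes "i \<noteq> k" "F i \<inter> F k \<noteq> {}"
  shows "\<exists>l p q. edge i k l p q"
proof -
  obtain k' l p q where e: "edge i k' l p q" using ex_edge by blast
  then have "k = k' \<or> k = l" using assms unfolding edge_def by metis
  then show ?thesis using e edge_swap by blast
qed

lemma edge_iff_meets:
  assumes "edge i k l p q" "m \<noteq> i"
  shows "F i \<inter> F m \<noteq> {} \<longleftrightarrow> m = k \<or> m = l"
  using assms unfolding edge_def by (metis insert_not_empty)

lemma edge_endpoints:
  assumes "edge i k l p q"
  shows "p \<in> P" "q \<in> P" "\<eta> i \<bullet> p = \<kappa> $ i" "\<eta> i \<bullet> q = \<kappa> $ i" "\<eta> k \<bullet> p = \<kappa> $ k" "\<eta> l \<bullet> q = \<kappa> $ l"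
    "\<eta> k \<bullet> q < \<kappa> $ k" "\<eta> l \<bullet> p < \<kappa> $ l"
proof -
  have "p \<in> F i" "p \<in> F k" "q \<in> F i" "q \<in> F l" "q \<notin> F k" "p \<notin> F l"
    using assms unfolding edge_def by auto
  then show "p \<in> P" "q \<in> P" "\<eta> i \<bullet> p = \<kappa> $ i" "\<eta> i \<bullet> q = \<kappa> $ i" "\<eta> k \<bullet> p = \<kappa> $ k"
    "\<eta> l \<bullet> q = \<kappa> $ l" "\<eta> k \<bullet> q < \<kappa> $ k" "\<eta> l \<bullet> p < \<kappa> $ l"
    by (auto simp: poly_facet_iff poly_set_iff order_less_le)
qed

section \<open>The chamber near a polygon\<close>

text \<open>Facets without a common point stay uniformly apart.\<close>

lemma facets_gap:
  "\<exists>d>0. \<forall>I. (\<Inter>i\<in>I. F i) = {} \<longrightarrow> (\<forall>x\<in>P. (\<Sum>i\<in>I. \<kappa> $ i - \<eta> i \<bullet> x) \<ge> d)"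
proof -
  have one: "\<exists>d>0. (\<Inter>i\<in>I. F i) = {} \<longrightarrow> (\<forall>x\<in>P. (\<Sum>i\<in>I. \<kappa> $ i - \<eta> i \<bullet> x) \<ge> d)" for I
  proof (cases "(\<Inter>i\<in>I. F i) = {}")
    case True
    let ?g = "\<lambda>x. \<Sum>i\<in>I. \<kappa> $ i - \<eta> i \<bullet> x"
    have "continuous_on P ?g" by (intro continuous_intros)
    then obtain x0 where x0: "x0 \<in> P" "\<And>x. x \<in> P \<Longrightarrow> ?g x0 \<le> ?g x"
      using continuous_attains_inf[OF compact_poly poly_nonempty] by blast
    have nonneg: "\<kappa> $ i - \<eta> i \<bullet> x0 \<ge> 0" for i
      using x0(1) by (simp add: poly_set_iff)
    have "?g x0 \<noteq> 0"
    proof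
      assume "?g x0 = 0"
      then have "\<forall>i\<in>I. \<kappa> $ i - \<eta> i \<bullet> x0 = 0"
        using sum_nonneg_eq_0_iff[of I "\<lambda>i. \<kappa> $ i - \<eta> i \<bullet> x0"] nonneg by simp
      then have "x0 \<in> (\<Inter>i\<in>I. F i)" using x0(1) by (simp add: poly_facet_iff)
      then show False using True by simp
    qed
    moreover have "?g x0 \<ge> 0" using nonneg by (simp add: sum_nonneg)
    ultimately have "?g x0 > 0" by simp
    then show ?thesis using x0(2) by blast
  qed (auto intro: exI[of _ 1])
  then obtain d where d: "\<And>I. d I > 0"
    "\<And>I. (\<Inter>i\<in>I. F i) = {} \<longrightarrow> (\<forall>x\<in>P. (\<Sum>i\<in>I. \<kappa> $ i - \<eta> i \<bullet> x) \<ge> d I)"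
    by metis
  have fin: "finite (range d)" by simp
  have pos: "Min (range d) > 0" using d(1) fin by simp
  have le: "Min (range d) \<le> d I" for I using fin by simp
  have "\<forall>x\<in>P. Min (range d) \<le> (\<Sum>i\<in>I. \<kappa> $ i - \<eta> i \<bullet> x)" if "(\<Inter>i\<in>I. F i) = {}" for I
    using d(2)[of I] that by (auto intro: order_trans[OF le])
  then show ?thesis using pos by blast
qed

text \<open>Moving the facets slightly inwards keeps the polygon simple with the same facets. Inward
  movements are all that the argument needs, and they keep everything inside \<open>P\<close>.\<close>

lemma polygon_nearby:
  "\<exists>e>0. \<forall>\<kappa>'. (\<forall>i. \<kappa> $ i - e \<le> \<kappa>' $ i \<and> \<kappa>' $ i \<le> \<kappa> $ i) \<longrightarrow> polygon \<eta> \<kappa>'"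
proof -
  obtain z where z: "\<And>i. \<eta> i \<bullet> z < \<kappa> $ i" using strict_point by blast
  obtain y where y: "\<And>i. \<eta> i \<bullet> y i = \<kappa> $ i" "\<And>i j. j \<noteq> i \<Longrightarrow> \<eta> j \<bullet> y i < \<kappa> $ j"
    using facet_point by metis
  obtain d where d: "d > 0" "\<And>I x. (\<Inter>i\<in>I. F i) = {} \<Longrightarrow> x \<in> P \<Longrightarrow> (\<Sum>i\<in>I. \<kappa> $ i - \<eta> i \<bullet> x) \<ge> d"
    using facets_gap by blast
  \<comment> \<open>\<open>c i j\<close> bounds the change of the constraint \<open>j\<close> per unit of movement of the facet \<open>i\<close>.\<close>
  define c where "c i j = \<bar>\<eta> j \<bullet> \<eta> i\<bar> / (\<eta> i \<bullet> \<eta> i)" for i j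
  have ev: "\<forall>\<^sub>F e in at_right 0. e * C < S" if "S > 0" for C S :: real
  proof -
    have "((\<lambda>e. e * C) \<longlongrightarrow> 0 * C) (at_right 0)" by (intro tendsto_intros)
    then show ?thesis by (rule order_tendstoD(2)) (simp add: that)
  qed
  have "\<forall>\<^sub>F e in at_right 0. \<forall>i. e * 1 < \<kappa> $ i - \<eta> i \<bullet> z"
    by (intro eventually_all_finite ev) (simp add: z)
  moreover have "\<forall>\<^sub>F e in at_right 0. \<forall>i j. j \<noteq> i \<longrightarrow> e * (1 + c i j) < \<kappa> $ j - \<eta> j \<bullet> y i"
  proof (intro eventually_all_finite)
    fix i j
    show "\<forall>\<^sub>F e in at_right 0. j \<noteq> i \<longrightarrow> e * (1 + c i j) < \<kappa> $ j - \<eta> j \<bullet> y i"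
      using ev[of "\<kappa> $ j - \<eta> j \<bullet> y i" "1 + c i j"] y(2)[of j i] by (cases "j = i") auto
  qed
  moreover have "\<forall>\<^sub>F e in at_right 0. e * 3 < d"
    by (rule ev) (rule d(1))
  moreover have "\<forall>\<^sub>F e in at_right (0::real). e > 0" by (simp add: eventually_at_right_less)
  ultimately have "\<forall>\<^sub>F e in at_right 0. e > 0 \<and> (\<forall>i. e * 1 < \<kappa> $ i - \<eta> i \<bullet> z) \<and>
      (\<forall>i j. j \<noteq> i \<longrightarrow> e * (1 + c i j) < \<kappa> $ j - \<eta> j \<bullet> y i) \<and> e * 3 < d"
    by eventually_elim auto
  then have "\<exists>e. e > 0 \<and> (\<forall>i. e * 1 < \<kappa> $ i - \<eta> i \<bullet> z) \<and>
      (\<forall>i j. j \<noteq> i \<longrightarrow> e * (1 + c i j) < \<kappa> $ j - \<eta> j \<bullet> y i) \<and> e * 3 < d"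
    by (rule eventually_happens'[OF trivial_limit_at_right_real])
  then obtain e where e: "e > 0" "\<And>i. e * 1 < \<kappa> $ i - \<eta> i \<bullet> z"
      "\<And>i j. j \<noteq> i \<Longrightarrow> e * (1 + c i j) < \<kappa> $ j - \<eta> j \<bullet> y i" "e * 3 < d"
    by blast
  have "polygon \<eta> \<kappa>'" if \<kappa>': "\<And>i. \<kappa> $ i - e \<le> \<kappa>' $ i \<and> \<kappa>' $ i \<le> \<kappa> $ i" for \<kappa>'
  proof
    have sub: "poly_set \<eta> \<kappa>' \<subseteq> P"
      using conjunct2[OF \<kappa>'] unfolding poly_set_iff subset_iff by (meson order_trans)
    show "DIM('a) = 2" by (rule dim2)
    show "bounded (poly_set \<eta> \<kappa>')" using sub bounded_poly bounded_subset by blast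
    have "\<eta> i \<bullet> z < \<kappa>' $ i" for i using e(2)[of i] \<kappa>'[of i] by linarith
    then show "\<exists>x. \<forall>i. \<eta> i \<bullet> x < \<kappa>' $ i" by blast
    show "\<eta> i \<noteq> 0" for i by (rule conormal_nonzero)
    show "\<exists>y. \<eta> i \<bullet> y = \<kappa>' $ i \<and> (\<forall>j. j \<noteq> i \<longrightarrow> \<eta> j \<bullet> y < \<kappa>' $ j)" for i
    proof (intro exI conjI allI impI)
      \<comment> \<open>Push the witness for \<open>\<kappa>\<close> back along \<open>\<eta> i\<close> until it lies on the moved line.\<close>
      let ?t = "(\<kappa> $ i - \<kappa>' $ i) / (\<eta> i \<bullet> \<eta> i)"
      show "\<eta> i \<bullet> (y i - ?t *\<^sub>R \<eta> i) = \<kappa>' $ i"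
        using conormal_nonzero[of i] by (simp add: inner_diff_right y(1))
      fix j assume j: "j \<noteq> i"
      have "\<bar>?t * (\<eta> j \<bullet> \<eta> i)\<bar> = (\<kappa> $ i - \<kappa>' $ i) * c i j"
        using \<kappa>'[of i] by (simp add: c_def abs_mult abs_divide)
      also have "\<dots> \<le> e * c i j"
        using \<kappa>'[of i] by (intro mult_right_mono) (auto simp: c_def)
      finally have "- (?t * (\<eta> j \<bullet> \<eta> i)) \<le> e * c i j" by linarith
      moreover have "e + e * c i j < \<kappa> $ j - \<eta> j \<bullet> y i"
        using e(3)[OF j] by (simp add: distrib_left)
      ultimately show "\<eta> j \<bullet> (y i - ?t *\<^sub>R \<eta> i) < \<kappa>' $ j"
        using \<kappa>'[of j] unfolding inner_diff_right inner_scaleR_right by linarith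
    qed
    show "card {i. \<eta> i \<bullet> x = \<kappa>' $ i} \<le> 2" if x: "x \<in> poly_set \<eta> \<kappa>'" for x
    proof (rule ccontr)
      assume "\<not> card {i. \<eta> i \<bullet> x = \<kappa>' $ i} \<le> 2"
      then have "3 \<le> card {i. \<eta> i \<bullet> x = \<kappa>' $ i}" by simp
      then obtain I where I: "I \<subseteq> {i. \<eta> i \<bullet> x = \<kappa>' $ i}" "card I = 3"
        by (meson obtain_subset_with_card_n)
      have "(\<Inter>i\<in>I. F i) = {}"
      proof (rule equals0I)
        fix v assume "v \<in> (\<Inter>i\<in>I. F i)"
        moreover have "I \<noteq> {}" using I(2) by auto
        ultimately have "v \<in> P" "I \<subseteq> {i. \<eta> i \<bullet> v = \<kappa> $ i}"
          by (auto simp: poly_facet_iff)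
        then show False
          using card_tight[of v] card_mono[of "{i. \<eta> i \<bullet> v = \<kappa> $ i}" I] I(2) by simp
      qed
      then have "d \<le> (\<Sum>i\<in>I. \<kappa> $ i - \<eta> i \<bullet> x)"
        using d(2) x sub by blast
      also have "\<dots> \<le> (\<Sum>i\<in>I. e)"
        using I(1) \<kappa>' by (intro sum_mono) (auto simp: algebra_simps)
      also have "\<dots> = e * 3" using I(2) by simp
      finally show False using e(4) by simp
    qed
  qed
  then show ?thesis using e(1) by blast
qed

lemma chamber_connected:
  assumes "connected K" "\<kappa> \<in> K" "\<And>\<kappa>'. \<kappa>' \<in> K \<Longrightarrow> polygon \<eta> \<kappa>'"
  shows "K \<subseteq> chamber \<eta> \<kappa>"
  unfolding chamber_def using assms polygon.simple_polytope
  by (intro connected_component_maximal) auto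

lemma chamber_polygon:
  assumes "\<kappa>' \<in> chamber \<eta> \<kappa>"
  shows "polygon \<eta> \<kappa>'"
  using assms connected_component_subset[of "{\<kappa>'. simple_polytope \<eta> \<kappa>'}" \<kappa>]
    simple_polytope_iff_polygon[OF dim2] unfolding chamber_def by blast

lemma self_in_chamber: "\<kappa> \<in> chamber \<eta> \<kappa>"
  using chamber_connected[of "{\<kappa>}"] polygon_axioms by simp

lemma chamber_nearby:
  "\<exists>e>0. \<forall>\<kappa>'. (\<forall>i. \<kappa> $ i - e \<le> \<kappa>' $ i \<and> \<kappa>' $ i \<le> \<kappa> $ i) \<longrightarrow> \<kappa>' \<in> chamber \<eta> \<kappa>"
proof -
  obtain e where e: "e > 0"
    "\<And>\<kappa>'. (\<forall>i. \<kappa> $ i - e \<le> \<kappa>' $ i \<and> \<kappa>' $ i \<le> \<kappa> $ i) \<Longrightarrow> polygon \<eta> \<kappa>'"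
    using polygon_nearby by blast
  have "cbox (\<chi> i. \<kappa> $ i - e) \<kappa> \<subseteq> chamber \<eta> \<kappa>"
  proof (rule chamber_connected)
    show "connected (cbox (\<chi> i. \<kappa> $ i - e) \<kappa>)"
      by (intro convex_connected convex_box)
  qed (use e in \<open>auto simp: mem_box_cart\<close>)
  then show ?thesis
    using e(1) by (intro exI[of _ e]) (auto simp: mem_box_cart)
qed

text \<open>The support numbers of the image of \<open>P\<close> under \<open>x \<mapsto> v + r x\<close>.\<close>

definition homothety :: "'a \<Rightarrow> real \<Rightarrow> real ^ 'n" where
  "homothety v r = (\<chi> i. \<eta> i \<bullet> v + r * \<kappa> $ i)"

lemma homothety_facets:
  assumes "r > 0"
  shows "\<eta> i \<bullet> (v + r *\<^sub>R x) \<le> homothety v r $ i \<longleftrightarrow> \<eta> i \<bullet> x \<le> \<kappa> $ i"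
    and "\<eta> i \<bullet> (v + r *\<^sub>R x) = homothety v r $ i \<longleftrightarrow> \<eta> i \<bullet> x = \<kappa> $ i"
    and "\<eta> i \<bullet> (v + r *\<^sub>R x) < homothety v r $ i \<longleftrightarrow> \<eta> i \<bullet> x < \<kappa> $ i"
  using assms by (auto simp: homothety_def inner_add_right)

lemma homothety_surj:
  assumes "r > 0"
  obtains x' where "x = v + r *\<^sub>R (x' :: 'a)"
  using that[of "(1 / r) *\<^sub>R (x - v)"] assms by simp

lemma poly_set_homothety:
  assumes "r > 0"
  shows "poly_set \<eta> (homothety v r) = (\<lambda>x. v + r *\<^sub>R x) ` P"
proof (intro set_eqI iffI)
  fix x assume x: "x \<in> poly_set \<eta> (homothety v r)"
  obtain x' where x': "x = v + r *\<^sub>R x'" using homothety_surj[OF assms] by blast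
  then have "x' \<in> P" using x homothety_facets(1)[OF assms] by (simp add: poly_set_iff)
  then show "x \<in> (\<lambda>x. v + r *\<^sub>R x) ` P" using x' by blast
qed (use homothety_facets(1)[OF assms] in \<open>auto simp: poly_set_iff\<close>)

lemma polygon_homothety:
  assumes "r > 0"
  shows "polygon \<eta> (homothety v r)"
proof
  show "DIM('a) = 2" by (rule dim2)
  have "bounded ((+) v ` ((*\<^sub>R) r ` P))"
    by (intro bounded_translation bounded_scaling bounded_poly)
  then show "bounded (poly_set \<eta> (homothety v r))"
    by (simp add: poly_set_homothety[OF assms] image_image)
  obtain z where "\<And>i. \<eta> i \<bullet> z < \<kappa> $ i" using strict_point by blast
  then show "\<exists>x. \<forall>i. \<eta> i \<bullet> x < homothety v r $ i"
    using homothety_facets(3)[OF assms] by blast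
  show "\<exists>y. \<eta> i \<bullet> y = homothety v r $ i \<and> (\<forall>j. j \<noteq> i \<longrightarrow> \<eta> j \<bullet> y < homothety v r $ j)" for i
    using facet_point[of i] homothety_facets(2,3)[OF assms] by blast
  show "\<eta> i \<noteq> 0" for i by (rule conormal_nonzero)
  show "card {i. \<eta> i \<bullet> x = homothety v r $ i} \<le> 2" if x: "x \<in> poly_set \<eta> (homothety v r)" for x
  proof -
    obtain x' where x': "x = v + r *\<^sub>R x'" using homothety_surj[OF assms] by blast
    then have "x' \<in> P" using x homothety_facets(1)[OF assms] by (simp add: poly_set_iff)
    then show ?thesis using card_tight[of x'] homothety_facets(2)[OF assms] x' by simp
  qed
qed

text \<open>The homothets form a connected family, so they never leave the chamber.\<close>

lemma chamber_homothety:
  assumes "r > 0"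
  shows "homothety v r \<in> chamber \<eta> \<kappa>"
proof -
  have "(\<lambda>(v, r). homothety v r) ` (UNIV \<times> {0<..}) \<subseteq> chamber \<eta> \<kappa>"
  proof (rule chamber_connected)
    show "connected ((\<lambda>(v, r). homothety v r) ` (UNIV \<times> {0<..}))"
      unfolding homothety_def case_prod_unfold
      by (intro connected_continuous_image continuous_intros connected_Times) auto
    have "\<kappa> = homothety 0 1" by (simp add: homothety_def vec_eq_iff)
    then show "\<kappa> \<in> (\<lambda>(v, r). homothety v r) ` (UNIV \<times> {0<..})" by force
  qed (auto intro: polygon_homothety)
  then show ?thesis using assms by auto
qed

end

section \<open>Cutting off a strip along an edge\<close>

text \<open>The support numbers after moving the facet \<open>i\<close> inwards by \<open>s\<close>.\<close>

definition cut :: "real ^ 'n::finite \<Rightarrow> 'n \<Rightarrow> real \<Rightarrow> real ^ 'n" where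
  "cut \<kappa> i s = (\<chi> m. \<kappa> $ m - (if m = i then s else 0))"

lemma poly_set_cut:
  assumes "s \<ge> 0"
  shows "poly_set \<eta> (cut \<kappa> i s) = poly_set \<eta> \<kappa> \<inter> {x. \<eta> i \<bullet> x \<le> \<kappa> $ i - s}"
proof (intro set_eqI iffI)
  fix x assume x: "x \<in> poly_set \<eta> (cut \<kappa> i s)"
  have le: "\<eta> m \<bullet> x \<le> \<kappa> $ m - (if m = i then s else 0)" for m
    using x by (simp add: poly_set_iff cut_def)
  have "\<eta> m \<bullet> x \<le> \<kappa> $ m" for m
    using le[of m] assms by (simp split: if_splits)
  moreover have "\<eta> i \<bullet> x \<le> \<kappa> $ i - s"
    using le[of i] by simp
  ultimately show "x \<in> poly_set \<eta> \<kappa> \<inter> {x. \<eta> i \<bullet> x \<le> \<kappa> $ i - s}" by (simp add: poly_set_iff)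
qed (auto simp: poly_set_iff cut_def)

lemma poly_set_translate:
  fixes \<eta> :: "'n::finite \<Rightarrow> 'a::euclidean_space"
  shows "poly_set \<eta> (\<chi> m. \<eta> m \<bullet> v + \<kappa> $ m) = (+) v ` poly_set \<eta> \<kappa>"
proof (intro set_eqI iffI)
  fix x assume x: "x \<in> poly_set \<eta> (\<chi> m. \<eta> m \<bullet> v + \<kappa> $ m)"
  have "x - v \<in> poly_set \<eta> \<kappa>"
    using x by (simp add: poly_set_iff inner_diff_right algebra_simps)
  moreover have "x = v + (x - v)" by simp
  ultimately show "x \<in> (+) v ` poly_set \<eta> \<kappa>" by blast
qed (auto simp: poly_set_iff inner_add_right)

lemma sum_cut:
  fixes \<gamma> :: "'n::finite \<Rightarrow> real"
  shows "(\<Sum>m\<in>UNIV. \<gamma> m * cut \<kappa> i s $ m) = (\<Sum>m\<in>UNIV. \<gamma> m * \<kappa> $ m) - \<gamma> i * s"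
  by (simp add: cut_def right_diff_distrib sum_subtractf if_distrib[of "\<lambda>x. _ * x"] cong: if_cong)

text \<open>Lebesgue measure of the polytope as a function of the support numbers.\<close>

definition area :: "('n::finite \<Rightarrow> 'a::euclidean_space) \<Rightarrow> real ^ 'n \<Rightarrow> real" where
  "area \<eta> \<kappa> = measure lebesgue (poly_set \<eta> \<kappa>)"

context polygon
begin

text \<open>The area that is lost when the edge \<open>i\<close> moves inwards by \<open>s\<close>.\<close>

definition strip :: "'n \<Rightarrow> real \<Rightarrow> real" where
  "strip i s = area \<eta> \<kappa> - area \<eta> (cut \<kappa> i s)"

lemma strip_pos:
  assumes "s > 0"
  shows "strip i s > 0"
proof -
  obtain z where z: "\<And>m. \<eta> m \<bullet> z < \<kappa> $ m" using strict_point by blast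
  obtain y where y: "\<eta> i \<bullet> y = \<kappa> $ i" "\<And>j. j \<noteq> i \<Longrightarrow> \<eta> j \<bullet> y < \<kappa> $ j"
    using facet_point by metis
  have y_le: "\<eta> m \<bullet> y \<le> \<kappa> $ m" for m using y by (cases "m = i") (auto intro: less_imp_le)
  let ?U = "{x. \<forall>m. \<eta> m \<bullet> x < \<kappa> $ m} \<inter> {x. \<kappa> $ i - s < \<eta> i \<bullet> x}"
  \<comment> \<open>A point on the way from \<open>y\<close> to \<open>z\<close> is interior, and lies in the strip if it is close to \<open>y\<close>.\<close>
  define t where "t = min 1 (s / (2 * (\<kappa> $ i - \<eta> i \<bullet> z)))"
  have k: "\<kappa> $ i - \<eta> i \<bullet> z > 0" using z[of i] by simp
  have t: "0 < t" "t \<le> 1" "t * (\<kappa> $ i - \<eta> i \<bullet> z) \<le> s / 2"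
  proof -
    show "0 < t" "t \<le> 1" using assms k by (auto simp: t_def)
    have "t * (\<kappa> $ i - \<eta> i \<bullet> z) \<le> s / (2 * (\<kappa> $ i - \<eta> i \<bullet> z)) * (\<kappa> $ i - \<eta> i \<bullet> z)"
      using k by (intro mult_right_mono) (auto simp: t_def)
    also have "\<dots> = s / 2"
      using less_imp_neq[OF k] nonzero_mult_divide_mult_cancel_right[of "\<kappa> $ i - \<eta> i \<bullet> z" s 2]
      unfolding times_divide_eq_left by metis
    finally show "t * (\<kappa> $ i - \<eta> i \<bullet> z) \<le> s / 2" .
  qed
  let ?x = "(1 - t) *\<^sub>R y + t *\<^sub>R z"
  have "\<eta> m \<bullet> ?x < \<kappa> $ m" for m
  proof -
    have "(1 - t) * (\<eta> m \<bullet> y) \<le> (1 - t) * \<kappa> $ m" using t(2) y_le by (intro mult_left_mono) auto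
    moreover have "t * (\<eta> m \<bullet> z) < t * \<kappa> $ m" using t(1) z by simp
    ultimately show ?thesis by (simp add: inner_add_right algebra_simps)
  qed
  moreover have "\<kappa> $ i - s < \<eta> i \<bullet> ?x"
    using t(3) assms by (simp add: inner_add_right y(1) algebra_simps)
  ultimately have "?x \<in> ?U" by simp
  then have ne: "?U \<noteq> {}" by blast
  have "measure lebesgue (poly_set \<eta> (cut \<kappa> i s)) < measure lebesgue P"
  proof (rule measure_compact_strict_mono[OF _ compact_poly _ _ ne])
    show "compact (poly_set \<eta> (cut \<kappa> i s))"
      using assms by (simp add: poly_set_cut compact_Int_closed compact_poly closed_halfspace_le)
    show "open ?U" by (intro open_Int open_interior open_halfspace_gt)
    show "?U \<subseteq> P - poly_set \<eta> (cut \<kappa> i s)"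
      using interior_subset assms by (auto simp: poly_set_cut)
  qed (use assms in \<open>auto simp: poly_set_cut\<close>)
  then show ?thesis by (simp add: strip_def area_def)
qed

lemma meeting_facets_coordinates:
  assumes "i \<noteq> j" "F i \<inter> F j \<noteq> {}"
  obtains X where "\<eta> i \<bullet> X = a" "\<eta> j \<bullet> X = b"
proof -
  obtain u where u: "u \<noteq> 0" "\<eta> j \<bullet> u = 0"
    using orthogonal_to_vector_exists[of "\<eta> j"] dim2 by (auto simp: orthogonal_def)
  obtain v where v: "v \<noteq> 0" "\<eta> i \<bullet> v = 0"
    using orthogonal_to_vector_exists[of "\<eta> i"] dim2 by (auto simp: orthogonal_def)
  have "\<eta> i \<bullet> u \<noteq> 0" "\<eta> j \<bullet> v \<noteq> 0"
    using meeting_facets_separate[OF assms] u v by blast+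
  then have "\<eta> i \<bullet> ((a / (\<eta> i \<bullet> u)) *\<^sub>R u + (b / (\<eta> j \<bullet> v)) *\<^sub>R v) = a"
    "\<eta> j \<bullet> ((a / (\<eta> i \<bullet> u)) *\<^sub>R u + (b / (\<eta> j \<bullet> v)) *\<^sub>R v) = b"
    using u v by (auto simp: inner_add_right)
  then show thesis by (rule that)
qed

text \<open>Near the edge \<open>i\<close>, only the constraints of \<open>i\<close> and of its two neighbours matter.\<close>

lemma strip_shape:
  assumes "edge i k l p q"
  shows "\<exists>d>0. \<forall>r. 0 < r \<longrightarrow> r < d \<longrightarrow> P \<inter> {x. \<kappa> $ i - r \<le> \<eta> i \<bullet> x} =
    {x. \<kappa> $ i - r \<le> \<eta> i \<bullet> x \<and> \<eta> i \<bullet> x \<le> \<kappa> $ i \<and> \<eta> k \<bullet> x \<le> \<kappa> $ k \<and> \<eta> l \<bullet> x \<le> \<kappa> $ l}"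
proof -
  obtain d where d: "d > 0" "\<And>I x. (\<Inter>i\<in>I. F i) = {} \<Longrightarrow> x \<in> P \<Longrightarrow> (\<Sum>i\<in>I. \<kappa> $ i - \<eta> i \<bullet> x) \<ge> d"
    using facets_gap by blast
  have far: "\<eta> m \<bullet> x < \<kappa> $ m" if x: "x \<in> P" "\<kappa> $ i - d < \<eta> i \<bullet> x" and m: "m \<notin> {i, k, l}" for x m
  proof -
    have "F i \<inter> F m = {}" using edge_iff_meets[OF assms, of m] m by blast
    then have "(\<Inter>i\<in>{i, m}. F i) = {}" by simp
    then have "(\<Sum>i\<in>{i, m}. \<kappa> $ i - \<eta> i \<bullet> x) \<ge> d" using d(2) x(1) by blast
    moreover have "i \<noteq> m" using m by blast
    ultimately show ?thesis using x(2) by simp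
  qed
  have "P \<inter> {x. \<kappa> $ i - r \<le> \<eta> i \<bullet> x} =
    {x. \<kappa> $ i - r \<le> \<eta> i \<bullet> x \<and> \<eta> i \<bullet> x \<le> \<kappa> $ i \<and> \<eta> k \<bullet> x \<le> \<kappa> $ k \<and> \<eta> l \<bullet> x \<le> \<kappa> $ l}"
    (is "?A = ?T") if r: "0 < r" "r < d" for r
  proof -
    have T: "?T = {x. \<kappa> $ i - r \<le> \<eta> i \<bullet> x} \<inter> {x. \<eta> i \<bullet> x \<le> \<kappa> $ i} \<inter>
        {x. \<eta> k \<bullet> x \<le> \<kappa> $ k} \<inter> {x. \<eta> l \<bullet> x \<le> \<kappa> $ l}"
      by auto
    have "connected ?T"
      unfolding T by (intro convex_connected convex_Int convex_halfspace_le convex_halfspace_ge)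
    moreover have AT: "?A \<subseteq> ?T" by (auto simp: poly_set_iff)
    \<comment> \<open>\<open>?A\<close> is closed in the connected set \<open>?T\<close>, and open because all other constraints are strict.\<close>
    moreover have "openin (top_of_set ?T) ?A"
    proof -
      have "?A = ?T \<inter> {x. \<forall>m\<in>- {i, k, l}. \<eta> m \<bullet> x < \<kappa> $ m}" (is "_ = ?T \<inter> ?U")
      proof (intro equalityI subsetI)
        fix x assume x: "x \<in> ?A"
        then have "\<kappa> $ i - d < \<eta> i \<bullet> x" using r by auto
        then show "x \<in> ?T \<inter> ?U" using far x AT by blast
      next
        fix x assume x: "x \<in> ?T \<inter> ?U"
        have "\<eta> m \<bullet> x \<le> \<kappa> $ m" for m
          using x by (cases "m \<in> {i, k, l}") (auto intro: less_imp_le)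
        then show "x \<in> ?A" using x by (auto simp: poly_set_iff)
      qed
      moreover have "openin (top_of_set ?T) (?T \<inter> {x. \<forall>m\<in>- {i, k, l}. \<eta> m \<bullet> x < \<kappa> $ m})"
        by (rule openin_open_Int[OF open_strict_constraints])
      ultimately show ?thesis by simp
    qed
    moreover have "closedin (top_of_set ?T) ?A"
      using AT by (intro closed_subset closed_Int closed_poly_set closed_halfspace_ge) auto
    moreover have "p \<in> ?A"
      using edge_endpoints[OF assms] r by auto
    ultimately show ?thesis
      unfolding connected_clopen by blast
  qed
  then show ?thesis using d(1) by blast
qed

text \<open>The strip is a trapezoid. If its area is linear in its width, then slices of equal width have
  equal area; but one of two adjacent slices, shifted along one of the neighbouring edges, is
  contained in the other, so the trapezoid is a parallelogram.\<close>

lemma neighbours_parallel: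
  assumes "edge i k l p q" "e > 0" "\<And>s. 0 < s \<Longrightarrow> s \<le> e \<Longrightarrow> strip i (2 * s) = 2 * strip i s"
  shows "\<exists>c. \<eta> l = c *\<^sub>R \<eta> k"
proof -
  have ne: "i \<noteq> k" "i \<noteq> l" and meet: "F i \<inter> F k \<noteq> {}" "F i \<inter> F l \<noteq> {}"
    using assms(1) unfolding edge_def by auto
  \<comment> \<open>\<open>D\<close> points inwards along the edge \<open>k\<close>; the claim is that \<open>\<eta> l\<close> also vanishes on \<open>D\<close>, that
    is, \<open>b = 0\<close>.\<close>
  obtain D where D: "\<eta> i \<bullet> D = - 1" "\<eta> k \<bullet> D = 0"
    using meeting_facets_coordinates[OF ne(1) meet(1)] by metis
  define b where "b = \<eta> l \<bullet> D"
  \<comment> \<open>\<open>q + s Z\<close> lies in the middle of the lower slice, halfway between the line \<open>l\<close> and its shift by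
    \<open>s D\<close>: it witnesses that the two slices differ in area unless \<open>b = 0\<close>.\<close>
  obtain Z where Z: "\<eta> i \<bullet> Z = - 3 / 2" "\<eta> l \<bullet> Z = b / 2"
    using meeting_facets_coordinates[OF ne(2) meet(2)] by metis
  obtain d where d: "d > 0" "\<And>r. 0 < r \<Longrightarrow> r < d \<Longrightarrow> P \<inter> {x. \<kappa> $ i - r \<le> \<eta> i \<bullet> x} =
      {x. \<kappa> $ i - r \<le> \<eta> i \<bullet> x \<and> \<eta> i \<bullet> x \<le> \<kappa> $ i \<and> \<eta> k \<bullet> x \<le> \<kappa> $ k \<and> \<eta> l \<bullet> x \<le> \<kappa> $ l}"
    using strip_shape[OF assms(1)] by blast
  note ends = edge_endpoints[OF assms(1)]
  obtain s where s: "0 < s" "s \<le> e" "2 * s < d" "s * (\<eta> k \<bullet> Z) < \<kappa> $ k - \<eta> k \<bullet> q"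
  proof
    let ?g = "\<kappa> $ k - \<eta> k \<bullet> q" let ?s = "min e (min (d / 3) (?g / (2 * (1 + \<bar>\<eta> k \<bullet> Z\<bar>))))"
    have g: "?g > 0" using ends(7) by simp
    show "0 < ?s"
      using assms(2) d(1) g by (simp add: divide_pos_pos add_pos_nonneg)
    show "?s \<le> e" by simp
    have "?s \<le> d / 3" by (intro min.coboundedI2 min.cobounded1)
    then show "2 * ?s < d" using d(1) by linarith
    have "?s * (\<eta> k \<bullet> Z) \<le> ?s * (1 + \<bar>\<eta> k \<bullet> Z\<bar>)"
      using \<open>0 < ?s\<close> by (intro mult_left_mono) auto
    also have "\<dots> \<le> ?g / (2 * (1 + \<bar>\<eta> k \<bullet> Z\<bar>)) * (1 + \<bar>\<eta> k \<bullet> Z\<bar>)"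
      by (intro mult_right_mono) auto
    also have "\<dots> = ?g / 2"
      by (simp add: add_pos_nonneg field_simps add_nonneg_eq_0_iff)
    also have "\<dots> < ?g" using g by simp
    finally show "?s * (\<eta> k \<bullet> Z) < ?g" .
  qed
  let ?T = "\<lambda>r. P \<inter> {x. \<kappa> $ i - r \<le> \<eta> i \<bullet> x}"
  \<comment> \<open>The lower slice, with the line \<open>l\<close> moved to height \<open>c\<close>.\<close>
  let ?W = "\<lambda>c. {x. \<kappa> $ i - 2 * s \<le> \<eta> i \<bullet> x \<and> \<eta> i \<bullet> x \<le> \<kappa> $ i - s \<and> \<eta> k \<bullet> x \<le> \<kappa> $ k \<and> \<eta> l \<bullet> x \<le> c}"
  have cT: "compact (?T r)" for r
    by (intro compact_Int_closed compact_poly closed_halfspace_ge)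
  have strip_T: "strip i r = measure lebesgue (?T r)" if "0 < r" for r
    using measure_split_hyperplane[OF compact_poly conormal_nonzero[of i], of "\<kappa> $ i - r"] that
    by (simp add: strip_def area_def poly_set_cut)
  let ?R = "\<lambda>r. {x. \<kappa> $ i - r \<le> \<eta> i \<bullet> x \<and> \<eta> i \<bullet> x \<le> \<kappa> $ i \<and> \<eta> k \<bullet> x \<le> \<kappa> $ k \<and> \<eta> l \<bullet> x \<le> \<kappa> $ l}"
  have T1: "?T s = ?R s" and T2: "?T (2 * s) = ?R (2 * s)"
    using s(1,3) by (auto intro!: d(2))
  have T2s: "?T (2 * s) \<inter> {x. \<eta> i \<bullet> x \<le> \<kappa> $ i - s} = ?W (\<kappa> $ l)"
    unfolding T2 using s(1) by auto
  have "?T (2 * s) \<inter> {x. \<kappa> $ i - s \<le> \<eta> i \<bullet> x} = ?T s"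
    using s(1) by auto
  then have "strip i (2 * s) = measure lebesgue (?W (\<kappa> $ l)) + strip i s"
    using measure_split_hyperplane[OF cT conormal_nonzero[of i], of "2 * s" "\<kappa> $ i - s"] s(1) T2s
    by (simp add: strip_T)
  then have m_eq: "measure lebesgue (?W (\<kappa> $ l)) = measure lebesgue (?T s)"
    using assms(3)[OF s(1,2)] strip_T[OF s(1)] by simp
  have shift: "(+) (s *\<^sub>R D) ` ?T s = ?W (\<kappa> $ l + s * b)"
    unfolding T1
  proof (intro set_eqI iffI)
    fix x assume x: "x \<in> ?W (\<kappa> $ l + s * b)"
    have "x - s *\<^sub>R D \<in> ?R s"
      using x D by (simp add: inner_diff_right b_def)
    moreover have "x = s *\<^sub>R D + (x - s *\<^sub>R D)" by simp
    ultimately show "x \<in> (+) (s *\<^sub>R D) ` ?R s" by (rule image_eqI[rotated])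
  qed (use D in \<open>auto simp: inner_add_right b_def\<close>)
  have cW: "compact (?W (\<kappa> $ l))" "compact (?W (\<kappa> $ l + s * b))"
    unfolding T2s[symmetric] shift[symmetric]
    by (intro compact_translation compact_Int_closed[OF cT] closed_halfspace_le cT)+
  have mono: "measure lebesgue (?W c) < measure lebesgue (?W c')"
    if c: "compact (?W c)" "compact (?W c')" "c < \<kappa> $ l + s * b / 2" "\<kappa> $ l + s * b / 2 < c'" for c c'
  proof (rule measure_compact_strict_mono)
    let ?U = "{x. \<kappa> $ i - 2 * s < \<eta> i \<bullet> x} \<inter> {x. \<eta> i \<bullet> x < \<kappa> $ i - s} \<inter> {x. \<eta> k \<bullet> x < \<kappa> $ k} \<inter>
      {x. c < \<eta> l \<bullet> x} \<inter> {x. \<eta> l \<bullet> x < c'}"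
    show "open ?U" by (intro open_Int open_halfspace_lt open_halfspace_gt)
    have sZ: "s * (\<eta> l \<bullet> Z) = s * b / 2" by (simp add: Z(2))
    have "q + s *\<^sub>R Z \<in> ?U"
      using s Z(1) ends(4,6) c(3,4) by (simp add: inner_add_right sZ)
    then show "?U \<noteq> {}" by blast
  qed (use c in auto)
  have "measure lebesgue (?W (\<kappa> $ l + s * b)) = measure lebesgue (?W (\<kappa> $ l))"
    unfolding m_eq shift[symmetric] by (rule measure_translation)
  then have "b = 0"
    using mono[OF cW] mono[OF cW(2,1)] s(1) by (cases b "0 :: real" rule: linorder_cases) (auto simp: mult_pos_neg)
  then have "\<eta> l \<bullet> D = 0" by (simp add: b_def)
  moreover have "D \<noteq> 0" using D(1) by auto
  ultimately show ?thesis
    using perp_multiple_dim2[OF dim2 _ conormal_nonzero D(2)] by blast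
qed

end

section \<open>Mass linear functions\<close>

context polygon
begin

lemma center_of_mass_strict: "\<eta> m \<bullet> center_of_mass P < \<kappa> $ m"
proof -
  obtain z where z: "\<And>m. \<eta> m \<bullet> z < \<kappa> $ m" using strict_point by blast
  let ?s = "(\<kappa> $ m - \<eta> m \<bullet> z) / 2"
  let ?U = "{x. \<forall>m. \<eta> m \<bullet> x < \<kappa> $ m} \<inter> {x. \<eta> m \<bullet> x < \<kappa> $ m - ?s}"
  have "\<eta> m \<bullet> z < \<kappa> $ m - ?s" using z[of m] by (simp add: field_simps)
  then have "z \<in> ?U" using z by simp
  then have ne: "?U \<noteq> {}" by (rule ex_in_conv[THEN iffD1, OF exI])
  show ?thesis
  proof (rule center_of_mass_less[OF compact_poly _ ne])
    show "open ?U" by (intro open_Int open_interior open_halfspace_lt)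
    show "?U \<subseteq> P" using interior_subset by (rule le_infI1)
    show "?U \<subseteq> {x. \<eta> m \<bullet> x < \<kappa> $ m - ?s}" by (rule inf_le2)
    show "?s > 0" using z[of m] by simp
  qed (simp add: poly_set_iff)
qed

end

text \<open>A polygon with a mass linear function \<open>H\<close> and a fixed choice of its coefficients.\<close>

locale mass_linear_polygon = polygon \<eta> \<kappa>
  for \<eta> :: "'n::finite \<Rightarrow> 'a::euclidean_space" and \<kappa> +
  fixes H :: 'a and \<gamma> :: "'n \<Rightarrow> real" and C :: real
  assumes mass_linear_eq: "\<kappa>' \<in> chamber \<eta> \<kappa> \<Longrightarrow>
      H \<bullet> center_of_mass (poly_set \<eta> \<kappa>') = (\<Sum>i\<in>UNIV. \<gamma> i * \<kappa>' $ i) + C"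
    and H_nonzero: "H \<noteq> 0"
begin

text \<open>Translations determine \<open>H\<close> from the coefficients.\<close>

lemma H_eq: "H = (\<Sum>i\<in>UNIV. \<gamma> i *\<^sub>R \<eta> i)"
proof -
  have "H \<bullet> t = (\<Sum>i\<in>UNIV. \<gamma> i *\<^sub>R \<eta> i) \<bullet> t" for t
  proof -
    have "homothety t 1 = (\<chi> m. \<eta> m \<bullet> t + \<kappa> $ m)" by (simp add: homothety_def)
    then have "poly_set \<eta> (homothety t 1) = (+) t ` P"
      using poly_set_translate by metis
    then have "H \<bullet> (t + center_of_mass P) = (\<Sum>i\<in>UNIV. \<gamma> i * homothety t 1 $ i) + C"
      using mass_linear_eq[OF chamber_homothety[of 1 t]]
        center_of_mass_translate[OF compact_poly, of t] measure_poly_pos by simp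
    then show ?thesis
      using mass_linear_eq[OF self_in_chamber]
      by (simp add: homothety_def inner_add_right distrib_left sum.distrib inner_sum_left)
  qed
  then show ?thesis using vector_eq_rdot[of H "\<Sum>i\<in>UNIV. \<gamma> i *\<^sub>R \<eta> i"] by simp
qed

lemma ex_coefficient_nonzero: "\<exists>i. \<gamma> i \<noteq> 0"
proof (rule ccontr)
  assume "\<nexists>i. \<gamma> i \<noteq> 0"
  then show False using H_eq H_nonzero by simp
qed

lemma symmetric_facet_iff: "symmetric_facet \<eta> \<kappa> H i \<longleftrightarrow> \<gamma> i = 0"
proof
  assume sym: "symmetric_facet \<eta> \<kappa> H i"
  obtain e where e: "e > 0"
    "\<And>\<kappa>'. (\<forall>i. \<kappa> $ i - e \<le> \<kappa>' $ i \<and> \<kappa>' $ i \<le> \<kappa> $ i) \<Longrightarrow> \<kappa>' \<in> chamber \<eta> \<kappa>"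
    using chamber_nearby by blast
  have c: "cut \<kappa> i e \<in> chamber \<eta> \<kappa>" using e by (simp add: cut_def)
  moreover have "\<forall>j. j \<noteq> i \<longrightarrow> \<kappa> $ j = cut \<kappa> i e $ j" by (simp add: cut_def)
  ultimately have "H \<bullet> center_of_mass P = H \<bullet> center_of_mass (poly_set \<eta> (cut \<kappa> i e))"
    using sym self_in_chamber unfolding symmetric_facet_def by blast
  then have "\<gamma> i * e = 0"
    using mass_linear_eq[OF self_in_chamber] mass_linear_eq[OF c] by (simp add: sum_cut)
  then show "\<gamma> i = 0" using e(1) by simp
next
  assume "\<gamma> i = 0"
  then have "(\<Sum>m\<in>UNIV. \<gamma> m * \<kappa>1 $ m) = (\<Sum>m\<in>UNIV. \<gamma> m * \<kappa>2 $ m)"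
    if "\<forall>j. j \<noteq> i \<longrightarrow> \<kappa>1 $ j = \<kappa>2 $ j" for \<kappa>1 \<kappa>2
    using that by (intro sum.cong refl) (metis mult_zero_left)
  then show "symmetric_facet \<eta> \<kappa> H i"
    unfolding symmetric_facet_def by (simp add: mass_linear_eq)
qed

text \<open>\<open>H\<close> is not a multiple of a single conormal \<open>l\<close>: shrink the polygon towards a point of the facet
  \<open>l\<close>. The support number of \<open>l\<close> does not change, while the center of mass approaches the facet.\<close>

lemma ex_second_coefficient: "\<exists>m. m \<noteq> l \<and> \<gamma> m \<noteq> 0"
proof (rule ccontr)
  assume "\<nexists>m. m \<noteq> l \<and> \<gamma> m \<noteq> 0"
  then have 0: "\<gamma> m = 0" if "m \<noteq> l" for m using that by blast
  have Hl: "H = \<gamma> l *\<^sub>R \<eta> l"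
  proof -
    have "H = (\<Sum>i\<in>UNIV. if i = l then \<gamma> i *\<^sub>R \<eta> i else 0)"
      unfolding H_eq using 0 by (intro sum.cong) auto
    then show ?thesis by simp
  qed
  have gl: "\<gamma> l \<noteq> 0" using Hl H_nonzero by auto
  have sum0: "(\<Sum>i\<in>UNIV. \<gamma> i * \<kappa>' $ i) = \<gamma> l * \<kappa>' $ l" for \<kappa>' :: "real ^ 'n"
  proof -
    have "(\<Sum>i\<in>UNIV. \<gamma> i * \<kappa>' $ i) = (\<Sum>i\<in>UNIV. if i = l then \<gamma> i * \<kappa>' $ i else 0)"
      using 0 by (intro sum.cong) auto
    then show ?thesis by simp
  qed
  obtain k k' p q where "edge l k k' p q" using ex_edge by blast
  then obtain v where v: "v \<in> F l" unfolding edge_def by blast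
  let ?c = "\<eta> l \<bullet> center_of_mass P"
  define \<delta> where "\<delta> = \<kappa> $ l - ?c"
  have \<delta>: "\<delta> > 0" using center_of_mass_strict by (simp add: \<delta>_def)
  have "continuous_on P (\<lambda>x. \<eta> l \<bullet> x)" by (intro continuous_intros)
  then obtain y where y: "y \<in> P" "\<And>x. x \<in> P \<Longrightarrow> \<eta> l \<bullet> y \<le> \<eta> l \<bullet> x"
    using continuous_attains_inf[OF compact_poly poly_nonempty] by blast
  define M where "M = \<kappa> $ l - \<eta> l \<bullet> y"
  have M: "M \<ge> 0" using y(1) by (simp add: M_def poly_set_iff)
  \<comment> \<open>After shrinking by \<open>r\<close> every point, hence the center of mass, is within \<open>r M < \<delta>\<close> of the facet.\<close>
  define r where "r = \<delta> / (\<delta> + M)"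
  have r: "r > 0" "r * M < \<delta>"
    using \<delta> M by (auto simp: r_def field_simps add_pos_nonneg)
  let ?\<kappa> = "homothety ((1 - r) *\<^sub>R v) r"
  have kl: "?\<kappa> $ l = \<kappa> $ l"
    using v by (simp add: homothety_def poly_facet_iff algebra_simps)
  interpret h: polygon \<eta> ?\<kappa> by (rule polygon_homothety[OF r(1)])
  have "\<gamma> l * (\<eta> l \<bullet> center_of_mass (poly_set \<eta> ?\<kappa>)) = \<gamma> l * ?c"
    using mass_linear_eq[OF chamber_homothety[OF r(1)], of "(1 - r) *\<^sub>R v"]
      mass_linear_eq[OF self_in_chamber] by (simp add: sum0 kl Hl)
  then have eq: "\<eta> l \<bullet> center_of_mass (poly_set \<eta> ?\<kappa>) = ?c" using gl by simp
  have "\<eta> l \<bullet> center_of_mass (poly_set \<eta> ?\<kappa>) \<ge> \<kappa> $ l - r * M"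
  proof (rule center_of_mass_ge[OF h.compact_poly h.measure_poly_pos])
    fix x assume "x \<in> poly_set \<eta> ?\<kappa>"
    then obtain x' where x': "x' \<in> P" "x = (1 - r) *\<^sub>R v + r *\<^sub>R x'"
      by (auto simp: poly_set_homothety[OF r(1)])
    have "r * (\<eta> l \<bullet> y) \<le> r * (\<eta> l \<bullet> x')" using y(2)[OF x'(1)] r(1) by simp
    then show "\<kappa> $ l - r * M \<le> \<eta> l \<bullet> x"
      using v by (simp add: x'(2) M_def poly_facet_iff inner_add_right algebra_simps)
  qed
  then show False using r(2) by (simp add: eq \<delta>_def)
qed

text \<open>The basic relation. For facets that do not meet, the strips cut off along them are disjoint, so
  area and first moment have vanishing mixed second difference; for the product of the area with an
  affine function of the support numbers this is the following identity.\<close>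

lemma disjoint_facets_relation:
  assumes "i \<noteq> j" "F i \<inter> F j = {}"
  shows "\<exists>e>0. \<forall>s t. 0 < s \<longrightarrow> s \<le> e \<longrightarrow> 0 < t \<longrightarrow> t \<le> e \<longrightarrow>
    strip i s * \<gamma> j * t + strip j t * \<gamma> i * s = 0"
proof -
  obtain e where e: "e > 0"
    "\<And>\<kappa>'. (\<forall>i. \<kappa> $ i - e \<le> \<kappa>' $ i \<and> \<kappa>' $ i \<le> \<kappa> $ i) \<Longrightarrow> \<kappa>' \<in> chamber \<eta> \<kappa>"
    using chamber_nearby by blast
  obtain d where d: "d > 0" "\<And>I x. (\<Inter>i\<in>I. F i) = {} \<Longrightarrow> x \<in> P \<Longrightarrow> (\<Sum>i\<in>I. \<kappa> $ i - \<eta> i \<bullet> x) \<ge> d"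
    using facets_gap by blast
  have gap: "(\<kappa> $ i - \<eta> i \<bullet> x) + (\<kappa> $ j - \<eta> j \<bullet> x) \<ge> d" if "x \<in> P" for x
    using d(2)[of "{i, j}" x] assms that by simp
  have "strip i s * \<gamma> j * t + strip j t * \<gamma> i * s = 0"
    if st: "0 < s" "s \<le> min e (d / 3)" "0 < t" "t \<le> min e (d / 3)" for s t
  proof -
    let ?A = "poly_set \<eta> (cut \<kappa> i s)" and ?B = "poly_set \<eta> (cut \<kappa> j t)"
    let ?AB = "poly_set \<eta> (cut (cut \<kappa> i s) j t)"
    have A: "?A = P \<inter> {x. \<eta> i \<bullet> x \<le> \<kappa> $ i - s}" and B: "?B = P \<inter> {x. \<eta> j \<bullet> x \<le> \<kappa> $ j - t}"
      using st by (auto simp: poly_set_cut)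
    have AB: "?AB = ?A \<inter> ?B"
      using st assms(1) by (auto simp: poly_set_cut) (auto simp: cut_def)
    have cA: "compact ?A" and cB: "compact ?B"
      unfolding A B by (intro compact_Int_closed compact_poly closed_halfspace_le)+
    have un: "?A \<union> ?B = P"
    proof -
      have "x \<in> ?A \<union> ?B" if "x \<in> P" for x
        using gap[OF that] that st d(1) unfolding A B by auto
      then show ?thesis unfolding A B by blast
    qed
    have ch: "cut \<kappa> i s \<in> chamber \<eta> \<kappa>" "cut \<kappa> j t \<in> chamber \<eta> \<kappa>"
      "cut (cut \<kappa> i s) j t \<in> chamber \<eta> \<kappa>"
      using st assms(1) by (auto intro!: e(2) simp: cut_def)
    have moment: "integral (poly_set \<eta> \<kappa>') (\<lambda>x. H \<bullet> x) = area \<eta> \<kappa>' * ((\<Sum>i\<in>UNIV. \<gamma> i * \<kappa>' $ i) + C)"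
      if k: "\<kappa>' \<in> chamber \<eta> \<kappa>" for \<kappa>'
    proof -
      interpret k: polygon \<eta> \<kappa>' using chamber_polygon[OF k] .
      have "integral (poly_set \<eta> \<kappa>') (\<lambda>x. H \<bullet> x) = H \<bullet> integral (poly_set \<eta> \<kappa>') (\<lambda>x. x)"
        using inner_integral_compact[OF k.compact_poly] by simp
      also have "\<dots> = area \<eta> \<kappa>' * (H \<bullet> center_of_mass (poly_set \<eta> \<kappa>'))"
        using center_of_mass_integral[of "poly_set \<eta> \<kappa>'"] k.measure_poly_pos by (simp add: area_def)
      finally show ?thesis using mass_linear_eq[OF k] by simp
    qed
    have "area \<eta> \<kappa> + area \<eta> (cut (cut \<kappa> i s) j t) = area \<eta> (cut \<kappa> i s) + area \<eta> (cut \<kappa> j t)"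
      using integral_inclusion_exclusion[OF cA cB, of "\<lambda>x. 1 :: real"] un AB cA cB
      by (simp add: area_def measure_compact_eq_integral compact_poly compact_Int)
    moreover have "integral P (\<lambda>x. H \<bullet> x) + integral ?AB (\<lambda>x. H \<bullet> x)
        = integral ?A (\<lambda>x. H \<bullet> x) + integral ?B (\<lambda>x. H \<bullet> x)"
      using integral_inclusion_exclusion[OF cA cB, of "\<lambda>x. H \<bullet> x"] un AB
      by (simp add: continuous_intros)
    ultimately show ?thesis
      unfolding moment[OF self_in_chamber] moment[OF ch(1)] moment[OF ch(2)] moment[OF ch(3)]
        sum_cut strip_def by algebra
  qed
  then show ?thesis using e(1) d(1) by (intro exI[of _ "min e (d / 3)"]) auto
qed

text \<open>Strips have positive area, so the coefficients of two facets that do not meet vanish together.\<close>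

lemma disjoint_facets_asymmetric:
  assumes "i \<noteq> j" "F i \<inter> F j = {}" "\<gamma> i \<noteq> 0"
  shows "\<gamma> j \<noteq> 0"
proof
  assume 0: "\<gamma> j = 0"
  obtain e where e: "e > 0" "\<And>s t. 0 < s \<Longrightarrow> s \<le> e \<Longrightarrow> 0 < t \<Longrightarrow> t \<le> e \<Longrightarrow>
    strip i s * \<gamma> j * t + strip j t * \<gamma> i * s = 0"
    using disjoint_facets_relation[OF assms(1,2)] by blast
  have "strip j e * \<gamma> i * e = 0" using e(2)[of e e] e(1) 0 by simp
  then show False using strip_pos[of e j] e(1) assms(3) by simp
qed

text \<open>The basic relation, with the width on the side of \<open>j\<close> fixed, says that the area of the strip at \<open>i\<close>
  is linear in its width.\<close>

lemma asymmetric_neighbours_parallel: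
  assumes "edge i k l p q" "j \<notin> {i, k, l}" "\<gamma> i \<noteq> 0"
  shows "\<exists>c. c < 0 \<and> \<eta> l = c *\<^sub>R \<eta> k"
proof -
  have ij: "i \<noteq> j" "F i \<inter> F j = {}"
    using edge_iff_meets[OF assms(1), of j] assms(2) by blast+
  have gj: "\<gamma> j \<noteq> 0" using disjoint_facets_asymmetric[OF ij assms(3)] .
  obtain e where e: "e > 0" "\<And>s t. 0 < s \<Longrightarrow> s \<le> e \<Longrightarrow> 0 < t \<Longrightarrow> t \<le> e \<Longrightarrow>
    strip i s * \<gamma> j * t + strip j t * \<gamma> i * s = 0"
    using disjoint_facets_relation[OF ij] by blast
  have "strip i (2 * s) = 2 * strip i s" if s: "0 < s" "s \<le> e / 2" for s
  proof -
    have "strip i s * \<gamma> j * e + strip j e * \<gamma> i * s = 0"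
      by (rule e(2)) (use e(1) s in auto)
    moreover have "strip i (2 * s) * \<gamma> j * e + strip j e * \<gamma> i * (2 * s) = 0"
      by (rule e(2)) (use e(1) s in auto)
    ultimately have "(strip i (2 * s) - 2 * strip i s) * (\<gamma> j * e) = 0" by algebra
    then show ?thesis using gj e(1) by simp
  qed
  then obtain c where "\<eta> l = c *\<^sub>R \<eta> k"
    using neighbours_parallel[OF assms(1), of "e / 2"] e(1) by auto
  moreover have "k \<noteq> l" using assms(1) by (simp add: edge_def)
  ultimately show ?thesis using conormal_multiple_neg by blast
qed

text \<open>If \<open>w\<close> is parallel to all edges except \<open>i\<close> and \<open>j\<close>, then cutting along \<open>i\<close> is the same as cutting
  along \<open>j\<close> up to translation by a multiple of \<open>w\<close>. Hence the two strips have equal area, and the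
  basic relation compares the coefficients.\<close>

lemma opposite_coefficients:
  assumes "i \<noteq> j" "F i \<inter> F j = {}" "\<eta> i \<bullet> w > 0" "\<eta> j \<bullet> w < 0" "\<And>m. m \<noteq> i \<Longrightarrow> m \<noteq> j \<Longrightarrow> \<eta> m \<bullet> w = 0"
  shows "\<gamma> i * (\<eta> i \<bullet> w) = \<gamma> j * (\<eta> j \<bullet> w)"
proof -
  obtain e where e: "e > 0" "\<And>s t. 0 < s \<Longrightarrow> s \<le> e \<Longrightarrow> 0 < t \<Longrightarrow> t \<le> e \<Longrightarrow>
    strip i s * \<gamma> j * t + strip j t * \<gamma> i * s = 0"
    using disjoint_facets_relation[OF assms(1,2)] by blast
  define a where "a = \<eta> i \<bullet> w"
  define b where "b = - (\<eta> j \<bullet> w)"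
  have ab: "a > 0" "b > 0" using assms by (auto simp: a_def b_def)
  define r where "r = e / (a + b)"
  have r: "r > 0" "r * a \<le> e" "r * b \<le> e"
    using e(1) ab by (auto simp: r_def field_simps)
  have "(\<chi> m. \<eta> m \<bullet> (r *\<^sub>R w) + cut \<kappa> i (r * a) $ m) = cut \<kappa> j (r * b)"
    using assms(1,5) by (auto simp: vec_eq_iff cut_def a_def b_def)
  then have "poly_set \<eta> (cut \<kappa> j (r * b)) = (+) (r *\<^sub>R w) ` poly_set \<eta> (cut \<kappa> i (r * a))"
    using poly_set_translate[of \<eta> "r *\<^sub>R w" "cut \<kappa> i (r * a)"] by simp
  then have "area \<eta> (cut \<kappa> j (r * b)) = area \<eta> (cut \<kappa> i (r * a))"
    by (simp add: area_def measure_translation)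
  then have eq: "strip j (r * b) = strip i (r * a)" by (simp add: strip_def)
  have "strip i (r * a) * \<gamma> j * (r * b) + strip i (r * a) * \<gamma> i * (r * a) = 0"
    using e(2)[of "r * a" "r * b"] r ab eq by simp
  then have "(strip i (r * a) * r) * (\<gamma> j * b + \<gamma> i * a) = 0" by (simp add: algebra_simps)
  moreover have "strip i (r * a) * r \<noteq> 0" using strip_pos[of "r * a" i] r ab by simp
  ultimately have "\<gamma> j * b + \<gamma> i * a = 0" by (metis mult_eq_0_iff)
  then show ?thesis by (simp add: a_def b_def)
qed

end

section \<open>Robust symmetries\<close>

lemma extreme_points_of_injective_linear_image:
  fixes f :: "'a::euclidean_space \<Rightarrow> 'b::euclidean_space"
  assumes "linear f" "inj f"
  shows "{y. y extreme_point_of f ` S} = f ` {x. x extreme_point_of S}"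
proof -
  have "f x extreme_point_of f ` S \<longleftrightarrow> x extreme_point_of S" for x
    using face_of_linear_image[OF assms, of "{x}" S] by (simp add: face_of_singleton)
  moreover have "y \<in> f ` S" if "y extreme_point_of f ` S" for y
    using that by (simp add: extreme_point_of_def)
  ultimately show ?thesis by blast
qed

context polygon
begin

lemma poly_set_no_translation:
  assumes "\<And>x. x \<in> P \<Longrightarrow> x + t \<in> P"
  shows "t = 0"
proof -
  have "continuous_on P (\<lambda>x. t \<bullet> x)" by (intro continuous_intros)
  then obtain x where x: "x \<in> P" "\<And>y. y \<in> P \<Longrightarrow> t \<bullet> y \<le> t \<bullet> x"
    using continuous_attains_sup[OF compact_poly poly_nonempty] by blast
  have "t \<bullet> (x + t) \<le> t \<bullet> x" using x assms by blast
  then have "t \<bullet> t \<le> 0" by (simp add: inner_add_right)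
  then show ?thesis using inner_gt_zero_iff[of t] by linarith
qed

lemma symmetry_unique:
  assumes "symmetry_with_linear_part P A f" "symmetry_with_linear_part P A g"
  shows "f = g"
proof -
  obtain c where c: "\<And>x. f x = A x + c" and fP: "f ` P = P"
    using assms(1) by (auto simp: symmetry_with_linear_part_def)
  obtain d where d: "\<And>x. g x = A x + d" and gP: "g ` P = P"
    using assms(2) by (auto simp: symmetry_with_linear_part_def)
  have "d - c = 0"
  proof (rule poly_set_no_translation)
    fix x assume "x \<in> P"
    then obtain y where y: "y \<in> P" "x = f y" using fP by blast
    then have "x + (d - c) = g y" by (simp add: c d)
    then show "x + (d - c) \<in> P" using y(1) gP by blast
  qed
  then show ?thesis by (auto simp: c d)
qed

end

lemma symmetry_compose:
  assumes "symmetry_with_linear_part S A f" "symmetry_with_linear_part S B g"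
  shows "symmetry_with_linear_part S (B \<circ> A) (g \<circ> f)"
proof -
  obtain c d where "\<And>x. f x = A x + c" "\<And>x. g x = B x + d" and B: "linear B"
    using assms by (auto simp: symmetry_with_linear_part_def)
  then have "(g \<circ> f) x = (B \<circ> A) x + (B c + d)" for x
    by (simp add: linear_add)
  moreover have "(g \<circ> f) ` S = S"
    using assms by (metis image_comp symmetry_with_linear_part_def)
  moreover have "linear (B \<circ> A)"
    using assms by (auto simp: symmetry_with_linear_part_def intro: linear_compose)
  ultimately show ?thesis unfolding symmetry_with_linear_part_def by blast
qed

context polygon
begin

text \<open>Composing robust symmetries is legitimate because the symmetry of each \<open>\<Delta>(\<kappa>')\<close> with a given linear
  part is unique.\<close>

lemma facets_equivalent_trans:
  assumes "facets_equivalent \<eta> \<kappa> i j" "facets_equivalent \<eta> \<kappa> j k"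
  shows "facets_equivalent \<eta> \<kappa> i k"
proof -
  obtain A where A: "robust_symmetry \<eta> \<kappa> A"
    "\<And>\<kappa>' f. \<kappa>' \<in> chamber \<eta> \<kappa> \<Longrightarrow> symmetry_with_linear_part (poly_set \<eta> \<kappa>') A f \<Longrightarrow>
       f ` poly_facet \<eta> \<kappa>' i = poly_facet \<eta> \<kappa>' j"
    using assms(1) unfolding facets_equivalent_def by blast
  obtain B where B: "robust_symmetry \<eta> \<kappa> B"
    "\<And>\<kappa>' f. \<kappa>' \<in> chamber \<eta> \<kappa> \<Longrightarrow> symmetry_with_linear_part (poly_set \<eta> \<kappa>') B f \<Longrightarrow>
       f ` poly_facet \<eta> \<kappa>' j = poly_facet \<eta> \<kappa>' k"
    using assms(2) unfolding facets_equivalent_def by blast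
  have ex: "\<exists>f g. symmetry_with_linear_part (poly_set \<eta> \<kappa>') A f \<and>
      symmetry_with_linear_part (poly_set \<eta> \<kappa>') B g" if "\<kappa>' \<in> chamber \<eta> \<kappa>" for \<kappa>'
    using A(1) B(1) that unfolding robust_symmetry_def by blast
  have "robust_symmetry \<eta> \<kappa> (B \<circ> A)"
    unfolding robust_symmetry_def
  proof (intro conjI ballI)
    show "linear (B \<circ> A)"
      using A(1) B(1) by (auto simp: robust_symmetry_def intro: linear_compose)
  qed (use ex symmetry_compose in blast)
  moreover have "h ` poly_facet \<eta> \<kappa>' i = poly_facet \<eta> \<kappa>' k"
    if k': "\<kappa>' \<in> chamber \<eta> \<kappa>" and h: "symmetry_with_linear_part (poly_set \<eta> \<kappa>') (B \<circ> A) h" for \<kappa>' h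
  proof -
    obtain f g where fg: "symmetry_with_linear_part (poly_set \<eta> \<kappa>') A f"
      "symmetry_with_linear_part (poly_set \<eta> \<kappa>') B g"
      using ex[OF k'] by blast
    interpret k: polygon \<eta> \<kappa>' using chamber_polygon[OF k'] .
    have "h = g \<circ> f"
      using k.symmetry_unique[OF h symmetry_compose[OF fg]] .
    then show ?thesis
      using A(2)[OF k' fg(1)] B(2)[OF k' fg(2)] by (metis image_comp)
  qed
  ultimately show ?thesis unfolding facets_equivalent_def by blast
qed

lemma facets_equivalent_same_class:
  assumes "facets_equivalent \<eta> \<kappa> i j" "facets_equivalent \<eta> \<kappa> j i"
  shows "facets_equivalent \<eta> \<kappa> x i \<longleftrightarrow> facets_equivalent \<eta> \<kappa> x j"
  using assms facets_equivalent_trans by blast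

text \<open>If all conormals except those of \<open>i\<close> and \<open>j\<close> vanish on \<open>w\<close>, then the affine reflection along
  \<open>w\<close> that exchanges the conormals \<open>i\<close> and \<open>j\<close>, each scaled to be \<open>1\<close> or \<open>-1\<close> on \<open>w\<close>, is a robust
  symmetry.\<close>

lemma swap_symmetry:
  assumes ij: "i \<noteq> j" and w: "\<eta> i \<bullet> w > 0" "\<eta> j \<bullet> w < 0" "\<And>m. m \<noteq> i \<Longrightarrow> m \<noteq> j \<Longrightarrow> \<eta> m \<bullet> w = 0"
  defines "A \<equiv> \<lambda>x. x - ((\<eta> i \<bullet> x) / (\<eta> i \<bullet> w) + (\<eta> j \<bullet> x) / (\<eta> j \<bullet> w)) *\<^sub>R w"
  shows "robust_symmetry \<eta> \<kappa> A" "facets_equivalent \<eta> \<kappa> i j"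
proof -
  define a where "a = \<eta> i \<bullet> w"
  define b where "b = - (\<eta> j \<bullet> w)"
  have ab: "a > 0" "b > 0" using w by (auto simp: a_def b_def)
  have wab: "\<eta> i \<bullet> w = a" "\<eta> j \<bullet> w = - b" by (auto simp: a_def b_def)
  have A: "A x = x - ((\<eta> i \<bullet> x) / a - (\<eta> j \<bullet> x) / b) *\<^sub>R w" for x
    by (simp add: A_def wab)
  have lin: "linear A"
    by (rule linearI) (simp_all add: A inner_add_right algebra_simps add_divide_distrib)
  define f where "f \<kappa>' x = A x + (\<kappa>' $ i / a - \<kappa>' $ j / b) *\<^sub>R w" for \<kappa>' x
  have fi: "\<eta> i \<bullet> f \<kappa>' x - \<kappa>' $ i = a / b * (\<eta> j \<bullet> x - \<kappa>' $ j)" for \<kappa>' x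
    using ab by (simp add: f_def A inner_diff_right inner_add_right wab field_simps)
  have fj: "\<eta> j \<bullet> f \<kappa>' x - \<kappa>' $ j = b / a * (\<eta> i \<bullet> x - \<kappa>' $ i)" for \<kappa>' x
    using ab by (simp add: f_def A inner_diff_right inner_add_right wab field_simps)
  have fm: "\<eta> m \<bullet> f \<kappa>' x = \<eta> m \<bullet> x" if "m \<noteq> i" "m \<noteq> j" for m \<kappa>' x
    using w(3)[OF that] by (simp add: f_def A inner_diff_right inner_add_right)
  have ff: "f \<kappa>' (f \<kappa>' x) = x" for \<kappa>' x
  proof -
    have f: "f \<kappa>' y = y - ((\<eta> i \<bullet> y - \<kappa>' $ i) / a - (\<eta> j \<bullet> y - \<kappa>' $ j) / b) *\<^sub>R w" for y
      by (simp add: f_def A algebra_simps diff_divide_distrib)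
    have "f \<kappa>' (f \<kappa>' x) = f \<kappa>' x - (a / b * (\<eta> j \<bullet> x - \<kappa>' $ j) / a - b / a * (\<eta> i \<bullet> x - \<kappa>' $ i) / b) *\<^sub>R w"
      by (subst f) (simp only: fi fj)
    also have "a / b * (\<eta> j \<bullet> x - \<kappa>' $ j) / a - b / a * (\<eta> i \<bullet> x - \<kappa>' $ i) / b
        = - ((\<eta> i \<bullet> x - \<kappa>' $ i) / a - (\<eta> j \<bullet> x - \<kappa>' $ j) / b)"
      using ab by simp
    also have "f \<kappa>' x - - ((\<eta> i \<bullet> x - \<kappa>' $ i) / a - (\<eta> j \<bullet> x - \<kappa>' $ j) / b) *\<^sub>R w = x"
      by (subst f) (simp only: scaleR_minus_left diff_minus_eq_add diff_add_cancel)
    finally show ?thesis .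
  qed
  have in_P: "f \<kappa>' x \<in> poly_set \<eta> \<kappa>'" if x: "x \<in> poly_set \<eta> \<kappa>'" for \<kappa>' x
  proof -
    have "\<eta> m \<bullet> f \<kappa>' x \<le> \<kappa>' $ m" for m
    proof -
      consider "m = i" | "m = j" | "m \<noteq> i" "m \<noteq> j" by blast
      then show ?thesis
      proof cases
        case 1
        have "a / b * (\<eta> j \<bullet> x - \<kappa>' $ j) \<le> 0"
          using x ab by (intro mult_nonneg_nonpos) (auto simp: poly_set_iff)
        then show ?thesis using fi[of \<kappa>' x] 1 by simp
      next
        case 2
        have "b / a * (\<eta> i \<bullet> x - \<kappa>' $ i) \<le> 0"
          using x ab by (intro mult_nonneg_nonpos) (auto simp: poly_set_iff)
        then show ?thesis using fj[of \<kappa>' x] 2 by simp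
      qed (use x fm in \<open>simp add: poly_set_iff\<close>)
    qed
    then show ?thesis by (simp add: poly_set_iff)
  qed
  have sym: "symmetry_with_linear_part (poly_set \<eta> \<kappa>') A (f \<kappa>')" for \<kappa>'
    unfolding symmetry_with_linear_part_def
  proof (intro conjI lin)
    show "\<exists>c. \<forall>x. f \<kappa>' x = A x + c" unfolding f_def by blast
    show "f \<kappa>' ` poly_set \<eta> \<kappa>' = poly_set \<eta> \<kappa>'"
    proof (intro equalityI subsetI)
      fix x assume "x \<in> poly_set \<eta> \<kappa>'"
      then show "x \<in> f \<kappa>' ` poly_set \<eta> \<kappa>'"
        using in_P ff by (intro image_eqI[of _ _ "f \<kappa>' x"]) auto
    qed (use in_P in blast)
  qed
  show robust: "robust_symmetry \<eta> \<kappa> A"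
    unfolding robust_symmetry_def using lin sym by blast
  have "f \<kappa>' ` poly_facet \<eta> \<kappa>' i = poly_facet \<eta> \<kappa>' j" for \<kappa>'
  proof (intro equalityI subsetI)
    fix x assume "x \<in> f \<kappa>' ` poly_facet \<eta> \<kappa>' i"
    then obtain y where y: "y \<in> poly_set \<eta> \<kappa>'" "\<eta> i \<bullet> y = \<kappa>' $ i" "x = f \<kappa>' y"
      by (auto simp: poly_facet_iff)
    then show "x \<in> poly_facet \<eta> \<kappa>' j"
      using in_P[OF y(1)] fj[of \<kappa>' y] by (simp add: poly_facet_iff)
  next
    fix x assume x: "x \<in> poly_facet \<eta> \<kappa>' j"
    then have "f \<kappa>' x \<in> poly_facet \<eta> \<kappa>' i"
      using in_P[of x \<kappa>'] fi[of \<kappa>' x] by (simp add: poly_facet_iff)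
    then show "x \<in> f \<kappa>' ` poly_facet \<eta> \<kappa>' i"
      using ff[of \<kappa>' x] by (metis image_eqI)
  qed
  moreover have "g = f \<kappa>'"
    if k': "\<kappa>' \<in> chamber \<eta> \<kappa>" and g: "symmetry_with_linear_part (poly_set \<eta> \<kappa>') A g" for \<kappa>' g
  proof -
    interpret k: polygon \<eta> \<kappa>' using chamber_polygon[OF k'] .
    show ?thesis using k.symmetry_unique[OF g sym] .
  qed
  ultimately show "facets_equivalent \<eta> \<kappa> i j"
    unfolding facets_equivalent_def using robust by blast
qed

lemma swap_equivalent:
  assumes "i \<noteq> j" "\<eta> i \<bullet> w > 0" "\<eta> j \<bullet> w < 0" "\<And>m. m \<noteq> i \<Longrightarrow> m \<noteq> j \<Longrightarrow> \<eta> m \<bullet> w = 0"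
  shows "facets_equivalent \<eta> \<kappa> i j" "facets_equivalent \<eta> \<kappa> j i"
  using swap_symmetry(2)[of i j w] swap_symmetry(2)[of j i "- w"] assms by auto

text \<open>A swap forces the normalization of the two conormals: they take opposite values on \<open>w\<close>.\<close>

lemma normalized_swap:
  assumes ij: "i \<noteq> j" and w: "\<eta> i \<bullet> w > 0" "\<eta> j \<bullet> w < 0" "\<And>m. m \<noteq> i \<Longrightarrow> m \<noteq> j \<Longrightarrow> \<eta> m \<bullet> w = 0"
    and \<nu>: "normalized_conormals \<eta> \<kappa> \<nu>"
  shows "\<nu> i \<bullet> w + \<nu> j \<bullet> w = 0"
proof -
  let ?A = "\<lambda>x. x - ((\<eta> i \<bullet> x) / (\<eta> i \<bullet> w) + (\<eta> j \<bullet> x) / (\<eta> j \<bullet> w)) *\<^sub>R w"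
  have rob: "robust_symmetry \<eta> \<kappa> ?A" by (rule swap_symmetry(1)[OF ij w])
  then have lin: "linear ?A" by (simp add: robust_symmetry_def)
  obtain s where s: "s > 0" "\<nu> i = s *\<^sub>R \<eta> i"
    using \<nu> unfolding normalized_conormals_def by blast
  obtain m where m: "adjoint ?A (\<nu> i) = \<nu> m"
    using \<nu> rob unfolding normalized_conormals_def by blast
  obtain r where r: "r > 0" "\<nu> m = r *\<^sub>R \<eta> m"
    using \<nu> unfolding normalized_conormals_def by blast
  define c where "c = - (s * (\<eta> i \<bullet> w)) / (\<eta> j \<bullet> w)"
  have c: "c > 0" using s(1) w(1,2) by (simp add: c_def divide_pos_neg)
  have "x \<bullet> adjoint ?A (\<nu> i) = x \<bullet> (c *\<^sub>R \<eta> j)" for x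
  proof -
    have "x \<bullet> adjoint ?A (\<nu> i) = ?A x \<bullet> \<nu> i" by (rule adjoint_works[OF lin])
    also have "\<dots> = s * (\<eta> i \<bullet> ?A x)" by (simp add: s(2) inner_commute)
    also have "\<dots> = c * (\<eta> j \<bullet> x)"
      using w(1,2) by (simp add: c_def inner_diff_right field_simps)
    finally show ?thesis by (simp add: inner_commute)
  qed
  then have eq: "adjoint ?A (\<nu> i) = c *\<^sub>R \<eta> j"
    using vector_eq_ldot by blast
  then have rc: "r *\<^sub>R \<eta> m = c *\<^sub>R \<eta> j" using m r(2) by simp
  have "\<eta> m = (1 / r) *\<^sub>R (r *\<^sub>R \<eta> m)" using r(1) by simp
  also have "\<dots> = (c / r) *\<^sub>R \<eta> j" unfolding rc by simp
  finally have "\<eta> m = (c / r) *\<^sub>R \<eta> j" .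
  moreover have "\<not> c / r < 0" using c r(1) by (simp add: divide_less_0_iff)
  ultimately have "m = j"
    using conormal_multiple_neg[of j m "c / r"] by blast
  then have "\<nu> j = c *\<^sub>R \<eta> j" using eq m by simp
  then show ?thesis using w(2) by (simp add: s(2) c_def)
qed

section \<open>Normalized conormals\<close>

lemma finite_extreme_points: "finite {v. v extreme_point_of P}"
  by (rule finite_polyhedron_extreme_points[OF polyhedron_poly_set])

lemma convex_hull_extreme_points: "P = convex hull {v. v extreme_point_of P}"
  by (rule Krein_Milman_Minkowski[OF compact_poly convex_poly_set])

text \<open>The mean of the vertices, an interior point fixed by every symmetry.\<close>

definition vertex_mean :: 'a where
  "vertex_mean = (1 / real (card {v. v extreme_point_of P})) *\<^sub>R (\<Sum>v | v extreme_point_of P. v)"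

lemma card_extreme_points_pos: "card {v. v extreme_point_of P} > 0"
  using finite_extreme_points poly_nonempty convex_hull_extreme_points
  by (metis card_gt_0_iff convex_hull_empty)

lemma vertex_mean_strict: "\<eta> i \<bullet> vertex_mean < \<kappa> $ i"
proof -
  let ?E = "{v. v extreme_point_of P}"
  have le: "\<eta> i \<bullet> v \<le> \<kappa> $ i" if "v \<in> ?E" for v
    using that by (auto simp: extreme_point_of_def poly_set_iff)
  have "\<exists>v\<in>?E. \<eta> i \<bullet> v < \<kappa> $ i"
  proof (rule ccontr)
    assume "\<not> (\<exists>v\<in>?E. \<eta> i \<bullet> v < \<kappa> $ i)"
    then have "?E \<subseteq> {x. \<eta> i \<bullet> x = \<kappa> $ i}" using le by force
    then have "convex hull ?E \<subseteq> {x. \<eta> i \<bullet> x = \<kappa> $ i}"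
      by (rule hull_minimal) (rule convex_hyperplane)
    then have sub: "P \<subseteq> {x. \<eta> i \<bullet> x = \<kappa> $ i}"
      using convex_hull_extreme_points by simp
    obtain z where z: "\<forall>m. \<eta> m \<bullet> z < \<kappa> $ m" using strict_point by blast
    then have "z \<in> P" using interior_subset by blast
    then have "\<eta> i \<bullet> z = \<kappa> $ i" using sub by blast
    then show False using z less_irrefl by metis
  qed
  then have "(\<Sum>v\<in>?E. \<eta> i \<bullet> v) < (\<Sum>v\<in>?E. \<kappa> $ i)"
    using le by (intro sum_strict_mono_ex1 finite_extreme_points) auto
  then show ?thesis
    using card_extreme_points_pos
    by (simp add: vertex_mean_def inner_sum_right pos_divide_less_eq mult.commute)
qed

lemma symmetry_linear_part_bij:
  assumes "symmetry_with_linear_part P A f"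
  shows "inj A" "surj A"
proof -
  obtain c where c: "\<And>x. f x = A x + c" and fP: "f ` P = P" and lin: "linear A"
    using assms by (auto simp: symmetry_with_linear_part_def)
  have "P = (+) c ` (A ` P)"
    using fP by (simp add: image_image c add.commute)
  then have "affine hull P = (+) c ` (A ` (affine hull P))"
    using affine_hull_translation[of c "A ` P"]
      affine_hull_linear_image[OF linear_conv_bounded_linear[THEN iffD1, OF lin], of P] by simp
  then have u: "UNIV = (+) c ` range A" by (simp add: affine_hull_poly)
  have "y \<in> range A" for y
  proof -
    have "c + y \<in> (+) c ` range A" using u by blast
    then show ?thesis by auto
  qed
  then show "surj A" by blast
  then show "inj A" by (rule linear_surjective_imp_injective[OF lin _ refl])
qed

lemma symmetry_fixes_vertex_mean:
  assumes "symmetry_with_linear_part P A f"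
  shows "f vertex_mean = vertex_mean"
proof -
  obtain c where c: "\<And>x. f x = A x + c" and fP: "f ` P = P" and lin: "linear A"
    using assms by (auto simp: symmetry_with_linear_part_def)
  let ?E = "{v. v extreme_point_of P}" and ?n = "real (card {v. v extreme_point_of P})"
  have inj: "inj A" using symmetry_linear_part_bij(1)[OF assms] .
  have "P = (\<lambda>x. c + x) ` (A ` P)"
    using fP by (simp add: image_image c add.commute)
  then have "?E = {v. v extreme_point_of ((\<lambda>x. c + x) ` (A ` P))}" by simp
  also have "\<dots> = (\<lambda>x. c + x) ` (A ` ?E)"
    by (simp only: extreme_points_of_translation extreme_points_of_injective_linear_image[OF lin inj])
  finally have E: "f ` ?E = ?E" by (simp add: image_image c add.commute)
  have "inj_on f ?E" using inj by (auto simp: inj_on_def c)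
  then have S: "(\<Sum>v\<in>?E. f v) = (\<Sum>v\<in>?E. v)"
    using sum.reindex[of f ?E "\<lambda>v. v"] E by simp
  have "(\<Sum>v\<in>?E. f v) = A (\<Sum>v\<in>?E. v) + ?n *\<^sub>R c"
    by (simp add: c sum.distrib linear_sum[OF lin] sum_constant_scaleR)
  then have "A (\<Sum>v\<in>?E. v) + ?n *\<^sub>R c = (\<Sum>v\<in>?E. v)" using S by simp
  then have "(1 / ?n) *\<^sub>R (A (\<Sum>v\<in>?E. v) + ?n *\<^sub>R c) = vertex_mean" by (simp add: vertex_mean_def)
  moreover have "(1 / ?n) *\<^sub>R (A (\<Sum>v\<in>?E. v) + ?n *\<^sub>R c) = f vertex_mean"
    using card_extreme_points_pos
    by (simp add: c vertex_mean_def linear_cmul[OF lin] scaleR_add_right)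
  ultimately show ?thesis by simp
qed

text \<open>Scaling every conormal so that its facet lies at height \<open>1\<close> above a point that is fixed by all
  symmetries gives normalized conormals: the scaled conormals are then the vertices of the dual
  polygon, which the adjoint of a symmetry permutes.\<close>

lemma ex_normalized_conormals: "\<exists>\<nu>. normalized_conormals \<eta> \<kappa> \<nu>"
proof -
  define g where "g i = \<kappa> $ i - \<eta> i \<bullet> vertex_mean" for i
  have g: "g i > 0" for i using vertex_mean_strict by (simp add: g_def)
  define \<nu> where "\<nu> i = (1 / g i) *\<^sub>R \<eta> i" for i
  have "\<exists>j. adjoint A (\<nu> i) = \<nu> j" if A: "robust_symmetry \<eta> \<kappa> A" for A i
  proof -
    obtain f where f: "symmetry_with_linear_part P A f"
      using A self_in_chamber unfolding robust_symmetry_def by blast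
    obtain c where c: "\<And>x. f x = A x + c" and fP: "f ` P = P" and lin: "linear A"
      using f by (auto simp: symmetry_with_linear_part_def)
    have diff: "A (x - y) = f x - f y" for x y by (simp add: c linear_diff[OF lin])
    obtain k l p q where e: "edge i k l p q" using ex_edge by blast
    note ends = edge_endpoints[OF e]
    have pq: "p \<noteq> q" using e by (simp add: edge_def)
    obtain p' q' where p': "p' \<in> P" "f p' = p" and q': "q' \<in> P" "f q' = q"
      using ends(1,2) fP by (metis imageE)
    have ne: "p' \<noteq> q'" using p' q' pq by auto
    let ?m = "midpoint p' q'"
    have m: "?m \<in> open_segment p' q'" using ne by simp
    have mP: "?m \<in> P"
      using p'(1) q'(1) convex_poly_set m by (meson convex_contains_open_segment subsetD)
    \<comment> \<open>The symmetry maps the segment from \<open>p'\<close> to \<open>q'\<close> onto the edge \<open>i\<close>, so its midpoint is not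
      interior.\<close>
    have "\<exists>j. \<eta> j \<bullet> ?m = \<kappa> $ j"
    proof (rule ccontr)
      assume no: "\<nexists>j. \<eta> j \<bullet> ?m = \<kappa> $ j"
      obtain w where w: "A w = \<eta> i"
        using symmetry_linear_part_bij(2)[OF f] by (metis surjD)
      obtain r where r: "r > 0" "?m + r *\<^sub>R w \<in> P"
        using poly_set_segment_through[OF mP, of w] no by blast
      have "f (?m + r *\<^sub>R w) = f ?m + r *\<^sub>R \<eta> i"
        by (simp add: c linear_add[OF lin] linear_cmul[OF lin] w)
      moreover have "\<eta> i \<bullet> f ?m = (\<eta> i \<bullet> f p' + \<eta> i \<bullet> f q') / 2"
        by (simp add: c midpoint_def linear_add[OF lin] linear_cmul[OF lin] inner_add_right)
      then have "\<eta> i \<bullet> f ?m = \<kappa> $ i"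
        by (simp add: p' q' ends)
      ultimately have "\<eta> i \<bullet> f (?m + r *\<^sub>R w) = \<kappa> $ i + r * (\<eta> i \<bullet> \<eta> i)"
        by (simp add: inner_add_right)
      moreover have "\<eta> i \<bullet> f (?m + r *\<^sub>R w) \<le> \<kappa> $ i"
        using r(2) fP by (metis image_eqI poly_set_iff)
      moreover have "r * (\<eta> i \<bullet> \<eta> i) > 0" using r(1) conormal_nonzero by simp
      ultimately show False by linarith
    qed
    then obtain j where j: "\<eta> j \<bullet> ?m = \<kappa> $ j" by blast
    have tight: "\<eta> j \<bullet> p' = \<kappa> $ j" "\<eta> j \<bullet> q' = \<kappa> $ j"
      using tight_open_segment[OF m _ _ j] p'(1) q'(1) by (auto simp: poly_set_iff)
    have adj: "adjoint A (\<nu> i) \<bullet> x = \<nu> i \<bullet> A x" for x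
      using adjoint_works[OF lin, of x "\<nu> i"] by (simp add: inner_commute)
    have "adjoint A (\<nu> i) \<bullet> (q' - p') = \<nu> i \<bullet> (q - p)"
      by (simp only: adj diff p'(2) q'(2))
    also have "\<dots> = 0"
      by (simp add: \<nu>_def inner_diff_right ends)
    finally have "adjoint A (\<nu> i) \<bullet> (q' - p') = 0" .
    moreover have "\<eta> j \<bullet> (q' - p') = 0" by (simp add: inner_diff_right tight)
    ultimately obtain r where r: "adjoint A (\<nu> i) = r *\<^sub>R \<eta> j"
      using perp_multiple_dim2[OF dim2, of "q' - p'" "\<eta> j" "adjoint A (\<nu> i)"] conormal_nonzero ne
      by auto
    have "adjoint A (\<nu> i) \<bullet> (p' - vertex_mean) = \<nu> i \<bullet> (p - vertex_mean)"
      by (simp only: adj diff p'(2) symmetry_fixes_vertex_mean[OF f])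
    also have "\<dots> = 1"
    proof -
      have "\<eta> i \<bullet> (p - vertex_mean) = g i" by (simp add: inner_diff_right ends g_def)
      then show ?thesis using g[of i] by (simp add: \<nu>_def)
    qed
    finally have "r * g j = 1"
      by (simp add: r inner_diff_right tight g_def right_diff_distrib)
    then have "r = 1 / g j" using g[of j] by (simp add: field_simps)
    then show ?thesis using r by (auto simp: \<nu>_def)
  qed
  moreover have "\<exists>s>0. \<nu> i = s *\<^sub>R \<eta> i" for i
    using g[of i] by (auto simp: \<nu>_def intro!: exI[of _ "1 / g i"])
  ultimately show ?thesis unfolding normalized_conormals_def by blast
qed

end

section \<open>Inessential functions\<close>

context mass_linear_polygon
begin

lemma inessential_if_classes:
  assumes "normalized_conormals \<eta> \<kappa> \<nu>" "H = (\<Sum>i\<in>UNIV. \<beta> i *\<^sub>R \<nu> i)"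
    and "\<And>x. (\<Sum>i | facets_equivalent \<eta> \<kappa> x i. \<beta> i) = 0"
  shows "inessential \<eta> \<kappa> H"
proof -
  have "(\<Sum>i\<in>I. \<beta> i) = 0" if I: "I \<in> UNIV // {(i, j). facets_equivalent \<eta> \<kappa> i j}" for I
  proof -
    obtain x where "I = {(i, j). facets_equivalent \<eta> \<kappa> i j} `` {x}"
      using I by (rule quotientE)
    then have "I = {i. facets_equivalent \<eta> \<kappa> x i}" by auto
    then show ?thesis using assms(3) by simp
  qed
  then show ?thesis unfolding inessential_def using assms(1,2) by blast
qed

lemma normalized_representation:
  assumes "normalized_conormals \<eta> \<kappa> \<nu>"
  obtains s where "\<And>m. s m > 0" "\<And>m. \<nu> m = s m *\<^sub>R \<eta> m" "H = (\<Sum>m\<in>UNIV. (\<gamma> m / s m) *\<^sub>R \<nu> m)"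
proof -
  obtain s where s: "\<And>m. s m > 0" "\<And>m. \<nu> m = s m *\<^sub>R \<eta> m"
    using assms unfolding normalized_conormals_def by metis
  have "(\<gamma> m / s m) *\<^sub>R \<nu> m = \<gamma> m *\<^sub>R \<eta> m" for m
    using s(1)[of m] by (simp add: s(2))
  then have "H = (\<Sum>m\<in>UNIV. (\<gamma> m / s m) *\<^sub>R \<nu> m)"
    by (simp only: H_eq)
  then show thesis by (rule that[OF s])
qed

end

section \<open>The interval as a polytope\<close>

lemma Delta1_facet: "poly_facet Delta1_conormal Delta1_support b = {if b then 1 else 0}"
  unfolding poly_facet_def Delta1_eq by (auto simp: Delta1_conormal_def Delta1_support_def)

lemma simple_polytope_Delta1: "simple_polytope Delta1_conormal Delta1_support"
  unfolding simple_polytope_def is_polytope_def Delta1_eq Delta1_facet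
proof (intro conjI allI impI)
  show "bounded {0..1 :: real}" by simp
  show "affine hull {0..1 :: real} = UNIV"
    by (rule affine_hull_nonempty_interior) simp
  fix v :: real
  assume "v extreme_point_of {0..1}"
  then have "v = 0 \<or> v = 1"
    using extreme_point_of_segment[of v 0 1] by (simp add: closed_segment_eq_real_ivl)
  then have "{b. v \<in> {if b then 1 else 0}} = {v = 1}" by auto
  then show "card {b. v \<in> {if b then 1 else 0}} = DIM(real)" by simp
qed (auto simp: DIM_real)

section \<open>Triangles\<close>

lemma mem_if_UNIV_eq: "UNIV = A \<Longrightarrow> x \<in> A"
  by auto

context polygon
begin

text \<open>The direction is that of the edge \<open>m\<close>, oriented from \<open>j\<close> to \<open>i\<close>.\<close>

lemma triangle_swap_direction:
  assumes "UNIV = {i, j, m}" "i \<noteq> j" "i \<noteq> m" "j \<noteq> m"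
  shows "\<exists>w. \<eta> i \<bullet> w > 0 \<and> \<eta> j \<bullet> w < 0 \<and> \<eta> m \<bullet> w = 0"
proof -
  obtain a b p q where "edge m a b p q" using ex_edge by blast
  moreover from this have "a \<noteq> m" "b \<noteq> m" "a \<noteq> b" by (auto simp: edge_def)
  then have "(a = i \<and> b = j) \<or> (a = j \<and> b = i)"
    using mem_if_UNIV_eq[OF assms(1), of a] mem_if_UNIV_eq[OF assms(1), of b] by auto
  ultimately obtain p q where e: "edge m i j p q" using edge_swap by blast
  show ?thesis
    using edge_endpoints[OF e] by (intro exI[of _ "p - q"]) (simp add: inner_diff_right)
qed

text \<open>A vertex of a triangle is determined by its two tight constraints, so there are at most three
  vertices; by dimension there are exactly three, and they are affinely independent.\<close>

lemma triangle_simplex: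
  assumes "card (UNIV :: 'n set) = 3"
  shows "2 simplex P"
proof -
  let ?E = "{v. v extreme_point_of P}" and ?t = "\<lambda>v. {m. \<eta> m \<bullet> v = \<kappa> $ m}"
  have "inj_on ?t ?E"
  proof (rule inj_onI)
    fix u v assume u: "u \<in> ?E" and v: "v \<in> ?E" and eq: "?t u = ?t v"
    obtain i j where ij: "?t u = {i, j}" "i \<noteq> j"
      using extreme_card_tight[of u] u by (auto simp: card_2_iff)
    have t: "\<eta> i \<bullet> u = \<kappa> $ i" "\<eta> j \<bullet> u = \<kappa> $ j" "\<eta> i \<bullet> v = \<kappa> $ i" "\<eta> j \<bullet> v = \<kappa> $ j"
      using ij(1) eq by blast+
    have "u \<in> F i \<inter> F j"
      using u t by (simp add: extreme_point_of_def poly_facet_iff)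
    then have "u - v = 0"
      using meeting_facets_separate[OF ij(2), of "u - v"] t by (auto simp: inner_diff_right)
    then show "u = v" by simp
  qed
  then have "card ?E = card (?t ` ?E)" by (simp add: card_image)
  also have "\<dots> \<le> card {B. B \<subseteq> (UNIV :: 'n set) \<and> card B = 2}"
    by (intro card_mono) (use extreme_card_tight in auto)
  also have "\<dots> = 3" using n_subsets[of "UNIV :: 'n set" 2] assms by (simp add: choose_two)
  finally have le: "card ?E \<le> 3" .
  have "aff_dim P = 2"
    using affine_hull_poly aff_dim_affine_hull[of P] dim2 by simp
  then have E2: "aff_dim ?E = 2"
    using aff_dim_convex_hull[of ?E] convex_hull_extreme_points by simp
  then have "card ?E \<ge> 3"
    using aff_dim_le_card[OF finite_extreme_points] by simp
  then have c: "card ?E = 3" using le by simp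
  then have "\<not> affine_dependent ?E"
    using E2 finite_extreme_points by (simp add: affine_independent_iff_card)
  then show ?thesis
    unfolding simplex_def using c convex_hull_extreme_points by (intro exI[of _ ?E]) auto
qed

end

context mass_linear_polygon
begin

lemma triangle_symmetric_facets:
  fixes i k l :: 'n
  assumes "UNIV = {i, k, l}" "i \<noteq> k" "i \<noteq> l" "k \<noteq> l"
  shows "card {m. symmetric_facet \<eta> \<kappa> H m} \<le> 1"
proof -
  have no_two: "\<not> (\<gamma> a = 0 \<and> \<gamma> b = 0)" if U: "UNIV = {a, b, c}" and ne: "c \<noteq> a" "c \<noteq> b" for a b c
  proof
    assume 0: "\<gamma> a = 0 \<and> \<gamma> b = 0"
    obtain m where "m \<noteq> c" "\<gamma> m \<noteq> 0" using ex_second_coefficient by blast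
    then show False using mem_if_UNIV_eq[OF U, of m] 0 by auto
  qed
  have U: "UNIV = {i, l, k}" "UNIV = {k, l, i}"
    using assms(1) by (simp_all add: insert_commute)
  have "\<not> (\<gamma> i = 0 \<and> \<gamma> k = 0)" by (rule no_two[OF assms(1)]) (use assms in auto)
  moreover have "\<not> (\<gamma> i = 0 \<and> \<gamma> l = 0)" by (rule no_two[OF U(1)]) (use assms in auto)
  moreover have "\<not> (\<gamma> k = 0 \<and> \<gamma> l = 0)" by (rule no_two[OF U(2)]) (use assms in auto)
  ultimately have "a = b" if "\<gamma> a = 0" "\<gamma> b = 0" for a b
    using that mem_if_UNIV_eq[OF assms(1), of a] mem_if_UNIV_eq[OF assms(1), of b] by auto
  then show ?thesis by (simp add: symmetric_facet_iff card_le_Suc0_iff_eq)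
qed

text \<open>The normalized conormals of a triangle sum to zero, so the coefficients of \<open>H\<close> can be shifted to
  have sum zero; and all three edges are equivalent.\<close>

lemma triangle_inessential:
  fixes i k l :: 'n
  assumes U: "UNIV = {i, k, l}" and ne: "i \<noteq> k" "i \<noteq> l" "k \<noteq> l"
  shows "inessential \<eta> \<kappa> H"
proof -
  obtain \<nu> where \<nu>: "normalized_conormals \<eta> \<kappa> \<nu>" using ex_normalized_conormals by blast
  obtain s where s: "\<And>m. s m > 0" "\<And>m. \<nu> m = s m *\<^sub>R \<eta> m" "H = (\<Sum>m\<in>UNIV. (\<gamma> m / s m) *\<^sub>R \<nu> m)"
    using normalized_representation[OF \<nu>] by blast
  have sum3: "(\<Sum>m\<in>UNIV. g m) = g i + (g k + g l)" for g :: "'n \<Rightarrow> 'c::comm_monoid_add"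
    unfolding U using ne by simp
  have U2: "UNIV = {i, l, k}" using U by (simp add: insert_commute)
  obtain w where w: "\<eta> i \<bullet> w > 0" "\<eta> k \<bullet> w < 0" "\<eta> l \<bullet> w = 0"
    using triangle_swap_direction[OF U ne] by blast
  obtain w' where w': "\<eta> i \<bullet> w' > 0" "\<eta> l \<bullet> w' < 0" "\<eta> k \<bullet> w' = 0"
    using triangle_swap_direction[OF U2] ne by blast
  have rest: "\<eta> m \<bullet> w = 0" if "m \<noteq> i" "m \<noteq> k" for m
    using that mem_if_UNIV_eq[OF U, of m] w(3) by auto
  have rest': "\<eta> m \<bullet> w' = 0" if "m \<noteq> i" "m \<noteq> l" for m
    using that mem_if_UNIV_eq[OF U, of m] w'(3) by auto
  let ?V = "\<Sum>m\<in>UNIV. \<nu> m"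
  have "?V \<bullet> w = 0"
    using normalized_swap[OF ne(1) w(1,2) rest \<nu>] w(3)
    by (simp add: sum3 inner_add_left s(2))
  have V': "?V \<bullet> w' = 0"
    using normalized_swap[OF ne(2) w'(1,2) rest' \<nu>] w'(3)
    by (simp add: sum3 inner_add_left s(2) algebra_simps)
  have "w \<noteq> 0" using w(1) by auto
  then obtain c where c: "?V = c *\<^sub>R \<eta> l"
    using perp_multiple_dim2[OF dim2 _ conormal_nonzero w(3) \<open>?V \<bullet> w = 0\<close>] by blast
  then have "c = 0" using V' w'(2) by simp
  then have V0: "?V = 0" using c by simp
  define a where "a = (\<Sum>m\<in>UNIV. \<gamma> m / s m) / 3"
  define \<beta> where "\<beta> m = \<gamma> m / s m - a" for m
  have eq: "facets_equivalent \<eta> \<kappa> i k" "facets_equivalent \<eta> \<kappa> k i"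
      "facets_equivalent \<eta> \<kappa> i l" "facets_equivalent \<eta> \<kappa> l i"
    using swap_equivalent[OF ne(1) w(1,2) rest] swap_equivalent[OF ne(2) w'(1,2) rest'] by blast+
  have all: "facets_equivalent \<eta> \<kappa> x y" for x y
  proof -
    have "facets_equivalent \<eta> \<kappa> i i" using eq facets_equivalent_trans by blast
    then have "facets_equivalent \<eta> \<kappa> x i" "facets_equivalent \<eta> \<kappa> i y"
      using eq mem_if_UNIV_eq[OF U, of x] mem_if_UNIV_eq[OF U, of y] by auto
    then show ?thesis using facets_equivalent_trans by blast
  qed
  show ?thesis
  proof (rule inessential_if_classes[OF \<nu>, of \<beta>])
    have "(\<Sum>m\<in>UNIV. \<beta> m *\<^sub>R \<nu> m) = (\<Sum>m\<in>UNIV. (\<gamma> m / s m) *\<^sub>R \<nu> m) - a *\<^sub>R ?V"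
      by (simp add: \<beta>_def scaleR_diff_left sum_subtractf scaleR_sum_right)
    then show "H = (\<Sum>m\<in>UNIV. \<beta> m *\<^sub>R \<nu> m)" using s(3) V0 by simp
    have "(\<Sum>m\<in>UNIV. \<beta> m) = (\<Sum>m\<in>UNIV. \<gamma> m / s m) - 3 * a"
      by (simp only: sum3 \<beta>_def)
    then show "(\<Sum>m | facets_equivalent \<eta> \<kappa> x m. \<beta> m) = 0" for x
      using all by (simp add: a_def)
  qed
qed

section \<open>Quadrilaterals\<close>

text \<open>Away from triangles, an asymmetric edge \<open>i\<close> has parallel neighbours \<open>k\<close> and \<open>l\<close>. The other
  neighbour \<open>j\<close> of \<open>k\<close> does not meet \<open>i\<close>, so it is asymmetric too and its neighbours are parallel; as
  one of them is \<open>k\<close>, the other is \<open>l\<close>. This closes up the polygon.\<close>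

lemma quadrilateral:
  assumes e: "edge i k l p q" and m: "m \<notin> {i, k, l}" and gi: "\<gamma> i \<noteq> 0"
  obtains j c w where "j \<notin> {i, k, l}" "UNIV = {i, j, k, l}" "c < 0" "\<eta> l = c *\<^sub>R \<eta> k"
    "F i \<inter> F j = {}" "F k \<inter> F l = {}" "F j \<inter> F k \<noteq> {}" "F j \<inter> F l \<noteq> {}" "\<gamma> j \<noteq> 0"
    "\<eta> i \<bullet> w > 0" "\<eta> j \<bullet> w < 0" "\<eta> k \<bullet> w = 0" "\<eta> l \<bullet> w = 0"
proof -
  have d: "i \<noteq> k" "i \<noteq> l" "k \<noteq> l" using e by (auto simp: edge_def)
  obtain c where c: "c < 0" "\<eta> l = c *\<^sub>R \<eta> k"
    using asymmetric_neighbours_parallel[OF e m gi] by blast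
  have kl: "F k \<inter> F l = {}" by (rule antiparallel_facets_disjoint[OF c(2,1)])
  have "F k \<inter> F i \<noteq> {}" using edge_iff_meets[OF e, of k] d by blast
  then obtain j where "\<exists>p q. edge k i j p q" using ex_edge_from[of k i] d by blast
  then obtain p' q' where e': "edge k i j p' q'" by blast
  have jd: "j \<noteq> i" "j \<noteq> k" "F k \<inter> F j \<noteq> {}"
    using e' unfolding edge_def by blast+
  have jl: "j \<noteq> l" using jd(3) kl by blast
  have jn: "j \<notin> {i, k, l}" using jd jl by blast
  have ij: "F i \<inter> F j = {}" using edge_iff_meets[OF e jd(1)] jn by blast
  have gj: "\<gamma> j \<noteq> 0" using disjoint_facets_asymmetric[OF _ ij gi] jd(1) by blast
  obtain l' pj qj where ej: "edge j k l' pj qj" using ex_edge_from[of j k] jd by blast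
  have jl': "F j \<inter> F l' \<noteq> {}" using ej unfolding edge_def by blast
  have "i \<notin> {j, k, l'}" using jd(1) d(1) jl' ij by blast
  then obtain c' where c': "c' < 0" "\<eta> l' = c' *\<^sub>R \<eta> k"
    using asymmetric_neighbours_parallel[OF ej _ gj] by blast
  have "\<eta> l' = (c' / c) *\<^sub>R \<eta> l" using c c' by simp
  moreover have "\<not> c' / c < 0" using c c' by (simp add: divide_less_0_iff)
  ultimately have "l' = l" using conormal_multiple_neg[of l l'] by blast
  then have ej: "edge j k l pj qj" and jl: "F j \<inter> F l \<noteq> {}" using ej jl' by auto
  note ei = edge_endpoints[OF e] and ejj = edge_endpoints[OF ej]
  define lo where "lo = \<kappa> $ l / c"
  have lo: "\<eta> k \<bullet> q = lo" "\<eta> k \<bullet> qj = lo"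
    using ei(6) ejj(6) c by (auto simp: lo_def field_simps)
  have Uni: "UNIV = {i, j, k, l}"
  proof (rule ccontr)
    assume "UNIV \<noteq> {i, j, k, l}"
    then obtain n where n: "n \<notin> {i, j, k, l}" by blast
    have ni: "F i \<inter> F n = {}" using edge_iff_meets[OF e, of n] n by blast
    have nj: "F j \<inter> F n = {}" using edge_iff_meets[OF ej, of n] n by blast
    obtain a0 b0 x y where "edge n a0 b0 x y" using ex_edge by blast
    then have x: "x \<in> F n" unfolding edge_def by blast
    then have xP: "x \<in> P" by (simp add: poly_facet_iff)
    \<comment> \<open>The line through \<open>x\<close> parallel to \<open>k\<close> and \<open>l\<close> meets the edges \<open>i\<close> and \<open>j\<close> in points \<open>a\<close> and \<open>b\<close>
      with \<open>x\<close> strictly between them; then \<open>n\<close>, tight at \<open>x\<close>, is also tight at \<open>a\<close>.\<close>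
    define u where "u = (\<kappa> $ k - \<eta> k \<bullet> x) / (\<kappa> $ k - lo)"
    have kpos: "\<kappa> $ k - lo > 0" using ei(7) lo by simp
    moreover have "\<eta> k \<bullet> x \<le> \<kappa> $ k" using xP by (simp add: poly_set_iff)
    moreover have "\<eta> l \<bullet> x \<le> \<kappa> $ l" using xP by (simp add: poly_set_iff)
    then have "lo \<le> \<eta> k \<bullet> x" using c by (simp add: lo_def divide_le_eq mult.commute)
    ultimately have u: "0 \<le> u" "u \<le> 1"
      by (auto simp: u_def divide_le_eq)
    have "u * (\<kappa> $ k - lo) = \<kappa> $ k - \<eta> k \<bullet> x"
      using kpos by (simp add: u_def)
    then have ux: "\<eta> k \<bullet> x = (1 - u) * \<kappa> $ k + u * lo"
      by (simp add: algebra_simps)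
    define a where "a = (1 - u) *\<^sub>R p + u *\<^sub>R q"
    define b where "b = (1 - u) *\<^sub>R pj + u *\<^sub>R qj"
    have aF: "a \<in> F i" and bF: "b \<in> F j"
      using e ej u(1,2) unfolding edge_def a_def b_def in_segment by (auto simp: in_segment)
    have ab: "\<eta> k \<bullet> a = \<eta> k \<bullet> x" "\<eta> k \<bullet> b = \<eta> k \<bullet> x"
      using ei(5) ejj(5) lo ux by (simp_all add: a_def b_def inner_add_right)
    have ne: "a \<noteq> b" using aF bF ij by blast
    have "\<exists>t. x - a = t *\<^sub>R (b - a)"
      by (rule perp_multiple_dim2[OF dim2 conormal_nonzero[of k]])
        (use ab ne in \<open>auto simp: inner_diff_right inner_commute[of _ "\<eta> k"]\<close>)
    then obtain t where "x - a = t *\<^sub>R (b - a)" by blast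
    then have t: "x = a + t *\<^sub>R (b - a)" by (simp only: diff_eq_eq add.commute)
    have bi: "\<eta> i \<bullet> b < \<kappa> $ i" "\<eta> i \<bullet> x < \<kappa> $ i" "\<eta> i \<bullet> a = \<kappa> $ i"
      and aj: "\<eta> j \<bullet> a < \<kappa> $ j" "\<eta> j \<bullet> x < \<kappa> $ j" "\<eta> j \<bullet> b = \<kappa> $ j"
      using aF bF x ij ni nj by (auto simp: poly_facet_iff poly_set_iff order_less_le)
    have "\<eta> i \<bullet> x = \<kappa> $ i - t * (\<kappa> $ i - \<eta> i \<bullet> b)"
      by (simp add: t inner_add_right inner_diff_right bi(3) algebra_simps)
    then have "t * (\<kappa> $ i - \<eta> i \<bullet> b) > 0" using bi(2) by simp
    then have t0: "t > 0" using bi(1) by (simp add: zero_less_mult_iff)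
    have "\<eta> j \<bullet> x = \<kappa> $ j - (1 - t) * (\<kappa> $ j - \<eta> j \<bullet> a)"
      by (simp add: t inner_add_right inner_diff_right aj(3) algebra_simps)
    then have "(1 - t) * (\<kappa> $ j - \<eta> j \<bullet> a) > 0" using aj(2) by simp
    then have t1: "t < 1" using aj(1) by (simp add: zero_less_mult_iff)
    have o: "x \<in> open_segment a b"
      unfolding in_segment using ne t0 t1 t by (auto simp: algebra_simps intro!: exI[of _ t])
    have "\<eta> n \<bullet> a = \<kappa> $ n"
      by (rule tight_open_segment(1)[OF o]) (use aF bF x in \<open>auto simp: poly_facet_iff poly_set_iff\<close>)
    then have "a \<in> F n" using aF by (simp add: poly_facet_iff)
    then show False using aF ni by blast
  qed
  have w: "\<eta> i \<bullet> (p - pj) > 0" "\<eta> j \<bullet> (p - pj) < 0" "\<eta> k \<bullet> (p - pj) = 0" "\<eta> l \<bullet> (p - pj) = 0"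
  proof -
    have "p \<in> F i" "pj \<in> F j" using e ej unfolding edge_def by auto
    then have "\<eta> i \<bullet> pj < \<kappa> $ i" "\<eta> j \<bullet> p < \<kappa> $ j"
      using ij by (auto simp: poly_facet_iff poly_set_iff order_less_le)
    then show "\<eta> i \<bullet> (p - pj) > 0" "\<eta> j \<bullet> (p - pj) < 0"
      using ei(3) ejj(3) by (simp_all add: inner_diff_right)
    show "\<eta> k \<bullet> (p - pj) = 0" using ei(5) ejj(5) by (simp add: inner_diff_right)
    then show "\<eta> l \<bullet> (p - pj) = 0" using c by simp
  qed
  show thesis
    using that[OF jn Uni c ij kl _ jl gj w] jd(3) by blast
qed

text \<open>Relative to normalized conormals, the coefficients of two opposite edges between parallel edges
  cancel.\<close>

lemma coefficients_cancel:
  assumes "i \<noteq> j" "F i \<inter> F j = {}" "\<eta> i \<bullet> w > 0" "\<eta> j \<bullet> w < 0" "\<And>m. m \<noteq> i \<Longrightarrow> m \<noteq> j \<Longrightarrow> \<eta> m \<bullet> w = 0"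
    and \<nu>: "normalized_conormals \<eta> \<kappa> \<nu>" and s: "\<And>m. s m > 0" "\<And>m. \<nu> m = s m *\<^sub>R \<eta> m"
  shows "\<gamma> i / s i + \<gamma> j / s j = 0"
proof -
  have 1: "\<gamma> i * (\<eta> i \<bullet> w) = \<gamma> j * (\<eta> j \<bullet> w)"
    by (rule opposite_coefficients[OF assms(1-5)])
  have 2: "s i * (\<eta> i \<bullet> w) + s j * (\<eta> j \<bullet> w) = 0"
    using normalized_swap[OF assms(1,3-5) \<nu>] by (simp add: s(2))
  have "(\<gamma> i * s j + \<gamma> j * s i) * (\<eta> i \<bullet> w) = 0"
    using 1 2 by algebra
  then have "\<gamma> i * s j + \<gamma> j * s i = 0" using assms(3) by simp
  then show ?thesis using s(1)[of i] s(1)[of j] by (simp add: field_simps)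
qed

text \<open>Two parallel edges make the other two equivalent with cancelling coefficients. The coefficients of
  the parallel edges themselves vanish, unless those have parallel neighbours as well.\<close>

lemma quadrilateral_inessential:
  assumes U: "UNIV = {i, j, k, l}" and d: "distinct [i, j, k, l]"
    and ij: "F i \<inter> F j = {}" "\<eta> i \<bullet> w > 0" "\<eta> j \<bullet> w < 0" "\<eta> k \<bullet> w = 0" "\<eta> l \<bullet> w = 0"
    and kl: "\<gamma> k = 0 \<and> \<gamma> l = 0 \<or>
      F k \<inter> F l = {} \<and> \<eta> k \<bullet> w' > 0 \<and> \<eta> l \<bullet> w' < 0 \<and> \<eta> i \<bullet> w' = 0 \<and> \<eta> j \<bullet> w' = 0"
  shows "inessential \<eta> \<kappa> H"
proof -
  obtain \<nu> where \<nu>: "normalized_conormals \<eta> \<kappa> \<nu>" using ex_normalized_conormals by blast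
  obtain s where s: "\<And>m. s m > 0" "\<And>m. \<nu> m = s m *\<^sub>R \<eta> m" "H = (\<Sum>m\<in>UNIV. (\<gamma> m / s m) *\<^sub>R \<nu> m)"
    using normalized_representation[OF \<nu>] by blast
  have ne: "i \<noteq> j" "k \<noteq> l" using d by auto
  have rest: "\<eta> m \<bullet> w = 0" if "m \<noteq> i" "m \<noteq> j" for m
    using that mem_if_UNIV_eq[OF U, of m] ij(4,5) by auto
  show ?thesis
  proof (rule inessential_if_classes[OF \<nu> s(3)])
    fix x
    let ?b = "\<lambda>m. if facets_equivalent \<eta> \<kappa> x m then \<gamma> m / s m else 0"
    have "(\<Sum>m | facets_equivalent \<eta> \<kappa> x m. \<gamma> m / s m) = (\<Sum>m\<in>UNIV. ?b m)"
      by (simp add: sum.If_cases)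
    also have "\<dots> = (?b i + ?b j) + (?b k + ?b l)"
      unfolding U using d by (simp add: add.assoc)
    also have "?b i + ?b j = 0"
      using facets_equivalent_same_class[OF swap_equivalent[OF ne(1) ij(2,3) rest]]
        coefficients_cancel[OF ne(1) ij(1-3) rest \<nu> s(1,2)] by simp
    also have "?b k + ?b l = 0"
      using kl
    proof (elim disjE conjE)
      assume k: "F k \<inter> F l = {}" "\<eta> k \<bullet> w' > 0" "\<eta> l \<bullet> w' < 0" "\<eta> i \<bullet> w' = 0" "\<eta> j \<bullet> w' = 0"
      have rest': "\<eta> m \<bullet> w' = 0" if "m \<noteq> k" "m \<noteq> l" for m
        using that mem_if_UNIV_eq[OF U, of m] k(4,5) by auto
      show ?thesis
        using facets_equivalent_same_class[OF swap_equivalent[OF ne(2) k(2,3) rest']]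
          coefficients_cancel[OF ne(2) k(1-3) rest' \<nu> s(1,2)] by simp
    qed simp
    finally show "(\<Sum>m | facets_equivalent \<eta> \<kappa> x m. \<gamma> m / s m) = 0" by simp
  qed
qed

end

context polygon
begin

text \<open>The parallel edges \<open>k\<close> and \<open>l\<close> are the fibre facets: the fibre direction is spanned by their common
  conormal, and the projection is the pairing with the direction \<open>w\<close> of these edges.\<close>

lemma quadrilateral_bundle:
  assumes U: "UNIV = {i, j, k, l}" and d: "distinct [i, j, k, l]"
    and disj: "F i \<inter> F j = {}" "F k \<inter> F l = {}"
    and meet: "F i \<inter> F k \<noteq> {}" "F i \<inter> F l \<noteq> {}" "F j \<inter> F k \<noteq> {}" "F j \<inter> F l \<noteq> {}"
    and c: "c < 0" "\<eta> l = c *\<^sub>R \<eta> k"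
    and w: "\<eta> i \<bullet> w > 0" "\<eta> j \<bullet> w < 0" "\<eta> k \<bullet> w = 0"
  defines "\<sigma> \<equiv> case_sum (\<lambda>b. if b then k else l) (\<lambda>b. if b then i else j)"
  shows "bundle_via \<sigma> \<eta> \<kappa> Delta1_conormal Delta1_support Delta1_conormal Delta1_support"
  unfolding bundle_via_def
proof (intro conjI simple_polytope_Delta1)
  have \<sigma>: "\<sigma> (Inl True) = k" "\<sigma> (Inl False) = l" "\<sigma> (Inr True) = i" "\<sigma> (Inr False) = j"
    by (auto simp: \<sigma>_def)
  let ?D = "product_facet Delta1_conormal Delta1_support Delta1_conormal Delta1_support"
  show "combinatorial_equivalence \<sigma> ?D F"
    unfolding combinatorial_equivalence_def
  proof (intro conjI allI)
    have "inj \<sigma>"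
      using d by (auto simp: inj_def \<sigma>_def split: sum.splits if_splits)
    moreover have "m \<in> range \<sigma>" for m
      using mem_if_UNIV_eq[OF U, of m] rangeI[of \<sigma>] \<sigma> by (auto dest: sym)
    ultimately show "bij \<sigma>" unfolding bij_def by blast
    fix I :: "(bool + bool) set"
    have D: "?D (Inl b) = {if b then 1 else 0} \<times> {0..1}" "?D (Inr b) = {0..1} \<times> {if b then 1 else 0}" for b
      by (simp_all add: product_facet_def Delta1_facet Delta1_eq)
    let ?opp = "Inl ` UNIV \<subseteq> I \<or> Inr ` UNIV \<subseteq> I"
    have "(\<Inter>f\<in>I. ?D f) \<noteq> {} \<longleftrightarrow> \<not> ?opp"
    proof
      assume "(\<Inter>f\<in>I. ?D f) \<noteq> {}"
      then obtain x where x: "\<And>f. f \<in> I \<Longrightarrow> x \<in> ?D f" by blast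
      show "\<not> ?opp"
      proof
        assume ?opp
        then consider "Inl True \<in> I" "Inl False \<in> I" | "Inr True \<in> I" "Inr False \<in> I" by blast
        then show False
        proof cases
          case 1
          then show False using x[of "Inl True"] x[of "Inl False"] by (auto simp: D)
        next
          case 2
          then show False using x[of "Inr True"] x[of "Inr False"] by (auto simp: D)
        qed
      qed
    next
      assume no: "\<not> ?opp"
      let ?x = "(if Inl True \<in> I then 1 else 0 :: real, if Inr True \<in> I then 1 else 0 :: real)"
      have "?x \<in> ?D f" if f: "f \<in> I" for f
      proof (cases f)
        case (Inl b)
        have "Inl True \<notin> I" if "\<not> b" using no f Inl that by (auto simp: UNIV_bool)
        then show ?thesis using f by (cases b) (auto simp: Inl D)
      next
        case (Inr b)
        have "Inr True \<notin> I" if "\<not> b" using no f Inr that by (auto simp: UNIV_bool)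
        then show ?thesis using f by (cases b) (auto simp: Inr D)
      qed
      then show "(\<Inter>f\<in>I. ?D f) \<noteq> {}" by blast
    qed
    also have "\<not> ?opp \<longleftrightarrow> (\<Inter>f\<in>I. F (\<sigma> f)) \<noteq> {}"
    proof
      assume "(\<Inter>f\<in>I. F (\<sigma> f)) \<noteq> {}"
      then obtain x where x: "\<And>f. f \<in> I \<Longrightarrow> x \<in> F (\<sigma> f)" by blast
      show "\<not> ?opp"
      proof
        assume ?opp
        then consider "Inl True \<in> I" "Inl False \<in> I" | "Inr True \<in> I" "Inr False \<in> I" by blast
        then show False
        proof cases
          case 1
          then show False using x[of "Inl True"] x[of "Inl False"] \<sigma> disj(2) by auto
        next
          case 2
          then show False using x[of "Inr True"] x[of "Inr False"] \<sigma> disj(1) by auto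
        qed
      qed
    next
      assume no: "\<not> ?opp"
      let ?a = "if Inl True \<in> I then k else l" and ?b = "if Inr True \<in> I then i else j"
      have "F ?b \<inter> F ?a \<noteq> {}" using meet by simp
      then obtain x where x: "x \<in> F ?a" "x \<in> F ?b" by blast
      have "x \<in> F (\<sigma> f)" if f: "f \<in> I" for f
      proof (cases f)
        case (Inl b)
        have "Inl True \<notin> I" if "\<not> b" using no f Inl that by (auto simp: UNIV_bool)
        then have "\<sigma> f = ?a" using f Inl \<sigma> by (cases b) auto
        then show ?thesis using x by simp
      next
        case (Inr b)
        have "Inr True \<notin> I" if "\<not> b" using no f Inr that by (auto simp: UNIV_bool)
        then have "\<sigma> f = ?b" using f Inr \<sigma> by (cases b) auto
        then show ?thesis using x by simp
      qed
      then show "(\<Inter>f\<in>I. F (\<sigma> f)) \<noteq> {}" by blast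
    qed
    finally show "(\<Inter>f\<in>I. ?D f) \<noteq> {} \<longleftrightarrow> (\<Inter>f\<in>I. F (\<sigma> f)) \<noteq> {}" .
  qed
  have w0: "w \<noteq> 0" using w(1) by auto
  show "\<exists>\<iota> \<pi>. linear \<iota> \<and> linear \<pi> \<and> inj \<iota> \<and> surj \<pi> \<and> range \<iota> = {x. \<pi> x = 0} \<and>
      (\<forall>b. \<exists>s>0. s *\<^sub>R \<eta> (\<sigma> (Inl b)) = \<iota> (Delta1_conormal b)) \<and>
      (\<forall>b. \<exists>s>0. \<pi> (s *\<^sub>R \<eta> (\<sigma> (Inr b))) = Delta1_conormal b)"
  proof (rule exI[of _ "\<lambda>t :: real. t *\<^sub>R \<eta> k"], rule exI[of _ "\<lambda>x. x \<bullet> w"], intro conjI allI)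
    let ?\<iota> = "\<lambda>t :: real. t *\<^sub>R \<eta> k" and ?\<pi> = "\<lambda>x. x \<bullet> w"
    show "linear ?\<iota>" by (simp add: linear_iff scaleR_left_distrib)
    show "linear ?\<pi>" by (simp add: linear_iff inner_add_left)
    show "inj ?\<iota>" using conormal_nonzero by (simp add: inj_def)
    show "surj ?\<pi>"
      by (rule surjI[of _ "\<lambda>r. (r / (w \<bullet> w)) *\<^sub>R w"]) (simp add: w0)
    show "range ?\<iota> = {x. ?\<pi> x = 0}"
    proof (intro equalityI subsetI)
      fix x assume "x \<in> {x. ?\<pi> x = 0}"
      then obtain t where "x = t *\<^sub>R \<eta> k"
        using perp_multiple_dim2[OF dim2 w0 conormal_nonzero w(3), of x] by blast
      then show "x \<in> range ?\<iota>" by blast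
    qed (use w(3) in auto)
    show "\<exists>s>0. s *\<^sub>R \<eta> (\<sigma> (Inl b)) = ?\<iota> (Delta1_conormal b)" for b
    proof (cases b)
      case True
      then show ?thesis by (intro exI[of _ 1]) (simp add: \<sigma> Delta1_conormal_def)
    next
      case False
      then show ?thesis using c
        by (intro exI[of _ "- 1 / c"]) (simp add: \<sigma> Delta1_conormal_def divide_less_0_iff)
    qed
    show "\<exists>s>0. ?\<pi> (s *\<^sub>R \<eta> (\<sigma> (Inr b))) = Delta1_conormal b" for b
    proof (cases b)
      case True
      then show ?thesis using w
        by (intro exI[of _ "1 / (\<eta> i \<bullet> w)"]) (simp add: \<sigma> Delta1_conormal_def)
    next
      case False
      then show ?thesis using w
        by (intro exI[of _ "- 1 / (\<eta> j \<bullet> w)"]) (simp add: \<sigma> Delta1_conormal_def divide_less_0_iff)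
    qed
  qed
qed

lemma parallelogram_isomorphic:
  assumes U: "UNIV = {i, j, k, l}" and ik: "i \<noteq> k" "F i \<inter> F k \<noteq> {}"
    and c: "c < 0" "\<eta> l = c *\<^sub>R \<eta> k" and b: "b < 0" "\<eta> j = b *\<^sub>R \<eta> i"
  shows "affinely_isomorphic (Delta1 \<times> Delta1) P"
proof -
  let ?u = "\<kappa> $ j / b" and ?v = "\<kappa> $ l / c"
  have P: "x \<in> P \<longleftrightarrow> ?u \<le> \<eta> i \<bullet> x \<and> \<eta> i \<bullet> x \<le> \<kappa> $ i \<and> ?v \<le> \<eta> k \<bullet> x \<and> \<eta> k \<bullet> x \<le> \<kappa> $ k" for x
  proof -
    have "x \<in> P \<longleftrightarrow> (\<forall>m\<in>{i, j, k, l}. \<eta> m \<bullet> x \<le> \<kappa> $ m)"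
      unfolding U[symmetric] by (simp add: poly_set_iff)
    also have "\<dots> \<longleftrightarrow> ?u \<le> \<eta> i \<bullet> x \<and> \<eta> i \<bullet> x \<le> \<kappa> $ i \<and> ?v \<le> \<eta> k \<bullet> x \<and> \<eta> k \<bullet> x \<le> \<kappa> $ k"
      using b c by (auto simp: divide_le_eq mult.commute)
    finally show ?thesis .
  qed
  define r where "r = \<kappa> $ i - ?u"
  define s where "s = \<kappa> $ k - ?v"
  obtain z where z: "\<And>m. \<eta> m \<bullet> z < \<kappa> $ m" using strict_point by blast
  then have "z \<in> P" using interior_subset by blast
  then have rs: "r > 0" "s > 0" using z[of i] z[of k] by (auto simp: P r_def s_def)
  obtain X where X: "\<eta> i \<bullet> X = r" "\<eta> k \<bullet> X = 0" using meeting_facets_coordinates[OF ik] by metis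
  obtain Y where Y: "\<eta> i \<bullet> Y = 0" "\<eta> k \<bullet> Y = s" using meeting_facets_coordinates[OF ik] by metis
  obtain Z where Z: "\<eta> i \<bullet> Z = ?u" "\<eta> k \<bullet> Z = ?v" using meeting_facets_coordinates[OF ik] by metis
  define g where "g = (\<lambda>t :: real \<times> real. fst t *\<^sub>R X + snd t *\<^sub>R Y)"
  have lin: "linear g"
    by (simp add: g_def linear_iff algebra_simps)
  have gi: "\<eta> i \<bullet> g t = fst t * r" and gk: "\<eta> k \<bullet> g t = snd t * s" for t
    by (simp_all add: g_def inner_add_right X Y)
  have sol: "g ((\<eta> i \<bullet> x) / r, (\<eta> k \<bullet> x) / s) = x" for x
  proof -
    have "g ((\<eta> i \<bullet> x) / r, (\<eta> k \<bullet> x) / s) - x = 0"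
      by (rule meeting_facets_separate[OF ik]) (use rs in \<open>auto simp: inner_diff_right gi gk\<close>)
    then show ?thesis by simp
  qed
  have "surj g"
    by (rule surjI[of g "\<lambda>x. ((\<eta> i \<bullet> x) / r, (\<eta> k \<bullet> x) / s)"]) (rule sol)
  moreover have "inj g"
  proof (rule injI)
    fix t t' assume "g t = g t'"
    then have "fst t * r = fst t' * r" "snd t * s = snd t' * s" using gi gk by metis+
    then show "t = t'" using rs by (simp add: prod_eq_iff)
  qed
  ultimately have "bij g" by (simp add: bij_def)
  moreover have "(\<lambda>t. g t + Z) ` (Delta1 \<times> Delta1) = P"
  proof (intro equalityI subsetI)
    fix x assume "x \<in> (\<lambda>t. g t + Z) ` (Delta1 \<times> Delta1)"
    then obtain t where t: "0 \<le> fst t" "fst t \<le> 1" "0 \<le> snd t" "snd t \<le> 1" "x = g t + Z"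
      by (auto simp: Delta1_eq)
    have "0 \<le> fst t * r" "fst t * r \<le> r" "0 \<le> snd t * s" "snd t * s \<le> s"
      using t rs by (auto simp: mult_left_le_one_le)
    then show "x \<in> P"
      unfolding P by (simp add: t(5) inner_add_right gi gk Z) (simp add: r_def s_def)
  next
    fix x assume x: "x \<in> P"
    let ?t = "((\<eta> i \<bullet> (x - Z)) / r, (\<eta> k \<bullet> (x - Z)) / s)"
    have "x = g ?t + Z" using sol[of "x - Z"] by simp
    moreover have "?t \<in> Delta1 \<times> Delta1"
      using x rs by (simp add: Delta1_eq P inner_diff_right Z) (simp add: r_def s_def)
    ultimately show "x \<in> (\<lambda>t. g t + Z) ` (Delta1 \<times> Delta1)" by blast
  qed
  ultimately show ?thesis unfolding affinely_isomorphic_def using lin by blast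
qed

end

section \<open>Classification\<close>

theorem proposition4p2:
  fixes \<eta> :: "'n::finite \<Rightarrow> 'a::euclidean_space" and \<kappa> :: "real ^ 'n" and H :: 'a
  assumes "DIM('a) = 2"
    and "simple_polytope \<eta> \<kappa>"
    and "mass_linear \<eta> \<kappa> H"
    and "H \<noteq> 0"
  shows "(2 simplex (poly_set \<eta> \<kappa>) \<and> card {i. symmetric_facet \<eta> \<kappa> H i} \<le> 1
        \<or> (\<exists>\<sigma> :: bool + bool \<Rightarrow> 'n.
             bundle_via \<sigma> \<eta> \<kappa> Delta1_conormal Delta1_support Delta1_conormal Delta1_support \<and>
             range (\<lambda>i. \<sigma> (Inr i)) = {i. asymmetric_facet \<eta> \<kappa> H i})
        \<or> affinely_isomorphic (Delta1 \<times> Delta1) (poly_set \<eta> \<kappa>) \<and>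
          (\<forall>i. asymmetric_facet \<eta> \<kappa> H i))
      \<and> inessential \<eta> \<kappa> H"
proof -
  interpret polygon \<eta> \<kappa> by (rule polygon_if_simple_polytope[OF assms(1,2)])
  obtain \<gamma> C where "\<forall>\<kappa>' \<in> chamber \<eta> \<kappa>.
      H \<bullet> center_of_mass (poly_set \<eta> \<kappa>') = (\<Sum>i\<in>UNIV. \<gamma> i * \<kappa>' $ i) + C"
    using assms(3) unfolding mass_linear_def by blast
  then interpret mass_linear_polygon \<eta> \<kappa> H \<gamma> C
    using assms(4) by unfold_locales auto
  obtain i where gi: "\<gamma> i \<noteq> 0" using ex_coefficient_nonzero by blast
  obtain k l p q where e: "edge i k l p q" using ex_edge by blast
  have d: "i \<noteq> k" "i \<noteq> l" "k \<noteq> l" using e by (auto simp: edge_def)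
  have meet: "F i \<inter> F k \<noteq> {}" "F i \<inter> F l \<noteq> {}" using e by (auto simp: edge_def)
  show ?thesis
  proof (cases "UNIV = {i, k, l}")
    case True
    have "card (UNIV :: 'n set) = card {i, k, l}" by (rule arg_cong[OF True])
    also have "\<dots> = 3" using d by simp
    finally have "card (UNIV :: 'n set) = 3" .
    then show ?thesis
      using triangle_simplex triangle_symmetric_facets[OF True d] triangle_inessential[OF True d]
      by blast
  next
    case False
    then obtain m where m: "m \<notin> {i, k, l}" by blast
    obtain j c w where j: "j \<notin> {i, k, l}" and U: "UNIV = {i, j, k, l}" and c: "c < 0" "\<eta> l = c *\<^sub>R \<eta> k"
      and disj: "F i \<inter> F j = {}" "F k \<inter> F l = {}" and meet': "F j \<inter> F k \<noteq> {}" "F j \<inter> F l \<noteq> {}"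
      and gj: "\<gamma> j \<noteq> 0"
      and w: "\<eta> i \<bullet> w > 0" "\<eta> j \<bullet> w < 0" "\<eta> k \<bullet> w = 0" "\<eta> l \<bullet> w = 0"
      by (rule quadrilateral[OF e m gi])
    have dist: "distinct [i, j, k, l]" using d j by auto
    have kl_iff: "\<gamma> k = 0 \<longleftrightarrow> \<gamma> l = 0"
      using disjoint_facets_asymmetric[of k l] disjoint_facets_asymmetric[of l k] disj(2) d(3) by blast
    show ?thesis
    proof (cases "\<gamma> k = 0")
      case True
      let ?\<sigma> = "case_sum (\<lambda>b. if b then k else l) (\<lambda>b. if b then i else j)"
      have "bundle_via ?\<sigma> \<eta> \<kappa> Delta1_conormal Delta1_support Delta1_conormal Delta1_support"
        by (rule quadrilateral_bundle[OF U dist disj meet meet' c w(1-3)])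
      moreover have "range (\<lambda>b. ?\<sigma> (Inr b)) = {m. asymmetric_facet \<eta> \<kappa> H m}"
      proof -
        have "{m. asymmetric_facet \<eta> \<kappa> H m} = {i, j}"
          using mem_if_UNIV_eq[OF U] True kl_iff gi gj by (auto simp: symmetric_facet_iff)
        then show ?thesis by (auto simp: UNIV_bool)
      qed
      moreover have "inessential \<eta> \<kappa> H"
        using quadrilateral_inessential[OF U dist disj(1) w] True kl_iff by blast
      ultimately show ?thesis by blast
    next
      case gk: False
      have "F k \<inter> F i \<noteq> {}" using meet(1) by blast
      then obtain j' p' q' where e': "edge k i j' p' q'" using ex_edge_from[of k i] d(1) by blast
      have "j' = j"
        using edge_iff_meets[OF e', of j] meet'(1) j by blast
      then have ek: "edge k i j p' q'" using e' by simp
      have "l \<notin> {k, i, j}" using dist by auto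
      then obtain b where b: "b < 0" "\<eta> j = b *\<^sub>R \<eta> i"
        using asymmetric_neighbours_parallel[OF ek _ gk] by blast
      obtain w' where w': "\<eta> i \<bullet> w' = 0" "\<eta> k \<bullet> w' = 1"
        using meeting_facets_coordinates[OF d(1) meet(1)] by metis
      have "inessential \<eta> \<kappa> H"
        using quadrilateral_inessential[OF U dist disj(1) w, of w'] disj(2) w' b c by simp
      moreover have "affinely_isomorphic (Delta1 \<times> Delta1) P"
        by (rule parallelogram_isomorphic[OF U d(1) meet(1) c b])
      moreover have "asymmetric_facet \<eta> \<kappa> H n" for n
        using mem_if_UNIV_eq[OF U, of n] gi gj gk kl_iff by (auto simp: symmetric_facet_iff)
      ultimately show ?thesis by blast
    qed
  qed
qed

end
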